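(* Let $N\ge 10000$ and $T\geq 1$ be integers, and let $\{s_i\}_{i=0}^{T-1}$ be a sample size sequence of positive integers with $s_i\le N$. Put $$K=\sum_{i=0}^{T-1}s_i,\qquad k=\frac{K}{N},\qquad \bar s=\frac1T\sum_{i=0}^{T-1}s_i=\frac KT,\qquad s_{max}=\max\{s_0,\dots,s_{T-1}\},\qquad \theta=\frac{s_{max}}{\bar s},$$ and assume $\theta\le 6.85$. Let $\epsilon,\delta,\sigma>0$ satisfy $$\sigma=\sqrt{\frac{2(\epsilon+\ln(1/\delta))}{\epsilon}},\qquad \delta\le\frac1N,\qquad \epsilon<0.5 .$$ Let $\gamma$ be the smallest positive real number such that, with $\bar\alpha=\frac{\epsilon}{\gamma k}$, one has $\bar\alpha<1$, $\sigma(1-\bar\alpha)-2e\sqrt{\bar\alpha}>0$ and $$\gamma\;\ge\;\frac{2}{1-\bar\alpha}+\frac{2^4\,\bar\alpha}{1-\bar\alpha}\left(\frac{\sigma}{(1-\sqrt{\bar\alpha})^2}+\frac{1}{\sigma(1-\bar\alpha)-2e\sqrt{\bar\alpha}}\cdot\frac{e^3}{\sigma}\right)e^{3/\sigma^2}.$$ If $$(2/e)^2\,k^2\ \ge\ \tfrac12+\ln(1/\delta)\qquad\text{and}\qquad T\ \ge\ \frac{\gamma\theta^2}{\epsilon}\,k^2,$$ then the DP-SGD algorithm with $T$ rounds, sample sizes $\{s_i\}$, data set size $N$ and noise parameter $\sigma$ is $(\epsilon,\delta)$-differentially private.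
   Context: **Adjacency and differential privacy.** Two data sets $d,d'$ are adjacent if one is obtained from the other by adding exactly one element; here the larger of the two has $N$ elements. A randomized mechanism $\mathcal M$ is $(\epsilon,\delta)$-differentially private if for all adjacent $d,d'$ (in either order) and all (measurable) sets $S$ of outputs, $\Pr[\mathcal M(d)\in S]\le e^{\epsilon}\Pr[\mathcal M(d')\in S]+\delta$. **Clipping.** For a constant $C>0$ and a vector $x$, $[x]_C=x/\max\{1,\|x\|/C\}$ (Euclidean norm), so $\|[x]_C\|\le C$. **DP-SGD algorithm.** Input: a client's data set $d$. Parameters: $N$, number of rounds $T$, sample sizes $s_0,\dots,s_{T-1}$, clipping constant $C>0$, noise parameter $\sigma>0$, and a loss $f(w,\xi)$ with gradient $\nabla f(w,\xi)$ in $w\in\mathbb R^m$. For $i=0,\dots,T-1$: 1. The client receives a model $\hat w$ from a server. The server's choice may depend arbitrarily (possibly randomly) on the previous outputs $U_0,\dots,U_{i-1}$ and on data independent of $d$, but not otherwise on $d$. 2. The client draws a random sample $J_i\subseteq d$ by including each element of $d$ independently with probability $s_i/N$ (so $s_i$ is the sample size in expectation), independently of everything else. 3. The client outputs $U_i=\sum_{\xi\in J_i}[\nabla f(\hat w,\xi)]_C+n_i$ with fresh Gaussian noise $n_i\sim\mathcal N(0,C^2\sigma^2\mathbf I)$. The output of the algorithm is $(U_0,\dots,U_{T-1})$. "The algorithm is $(\epsilon,\delta)$-differentially private" means this holds for every loss $f$, every clipping constant $C>0$ and every server behaviour as described. *)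

theory Defs
  imports "HOL-Probability.Probability"
begin

definition adjacent :: "nat \<Rightarrow> 'x set \<Rightarrow> 'x set \<Rightarrow> bool" where
  "adjacent N d d' \<longleftrightarrow>
     (\<exists>x. x \<notin> d \<and> d' = insert x d \<and> finite d' \<and> card d' = N) \<or>
     (\<exists>x. x \<notin> d' \<and> d = insert x d' \<and> finite d \<and> card d = N)"

text \<open>A mechanism maps a data set to the law of its output on the measurable space \<open>Out\<close>.\<close>

definition differentially_private ::
    "real \<Rightarrow> real \<Rightarrow> nat \<Rightarrow> 'o measure \<Rightarrow> ('x set \<Rightarrow> 'o measure) \<Rightarrow> bool" where
  "differentially_private \<epsilon> \<delta> N Out M \<longleftrightarrow>
     (\<forall>d d'. adjacent N d d' \<longrightarrow>
        (\<forall>S\<in>sets Out. measure (M d) S \<le> exp \<epsilon> * measure (M d') S + \<delta>))"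

definition clip :: "real \<Rightarrow> 'v::real_normed_vector \<Rightarrow> 'v" where
  "clip C x = x /\<^sub>R max 1 (norm x / C)"

definition loss_grad :: "(real^'m \<Rightarrow> 'x \<Rightarrow> real) \<Rightarrow> real^'m \<Rightarrow> 'x \<Rightarrow> real^'m" where
  "loss_grad f w \<xi> = (THE g. GDERIV (\<lambda>v. f v \<xi>) w :> g)"

text \<open>Each element of \<open>d\<close> is included independently with probability \<open>q\<close>.\<close>

definition random_subset :: "real \<Rightarrow> 'x set \<Rightarrow> 'x set pmf" where
  "random_subset q d =
     map_pmf (\<lambda>b. {\<xi>\<in>d. b \<xi>}) (Pi_pmf d False (\<lambda>_. bernoulli_pmf q))"

text \<open>The centred Gaussian with covariance matrix \<open>\<tau>\<^sup>2\<close> times the identity.\<close>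

definition gaussian :: "real \<Rightarrow> (real^'m) measure" where
  "gaussian \<tau> = density lborel (\<lambda>x. ennreal (\<Prod>j\<in>UNIV. normal_density 0 \<tau> (x $ j)))"

text \<open>The output tuples \<open>(U\<^sub>0, \<dots>, U\<^sub>i\<^sub>-\<^sub>1)\<close>.\<close>

abbreviation outputs :: "nat \<Rightarrow> (nat \<Rightarrow> real^'m) measure" where
  "outputs i \<equiv> PiM {..<i} (\<lambda>_. borel)"

text \<open>The law of the client's output when it receives the model \<open>w\<close>.\<close>

definition client_round ::
    "(real^'m \<Rightarrow> 'x \<Rightarrow> real) \<Rightarrow> real \<Rightarrow> real \<Rightarrow> real \<Rightarrow> 'x set \<Rightarrow> real^'m \<Rightarrow> (real^'m) measure" where
  "client_round f C \<sigma> q d w =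
     measure_pmf (random_subset q d) \<bind>
       (\<lambda>J. distr (gaussian (C * \<sigma>)) borel (\<lambda>n. (\<Sum>\<xi>\<in>J. clip C (loss_grad f w \<xi>)) + n))"

text \<open>The law of the first \<open>i\<close> outputs when the server is deterministic and sends the model
  \<open>srv i U\<close> in round \<open>i\<close> after having received the outputs \<open>U\<close>.\<close>

primrec dp_sgd_run ::
    "nat \<Rightarrow> (nat \<Rightarrow> nat) \<Rightarrow> (real^'m \<Rightarrow> 'x \<Rightarrow> real) \<Rightarrow> real \<Rightarrow> real
      \<Rightarrow> (nat \<Rightarrow> (nat \<Rightarrow> real^'m) \<Rightarrow> real^'m) \<Rightarrow> 'x set \<Rightarrow> nat \<Rightarrow> (nat \<Rightarrow> real^'m) measure" where
  "dp_sgd_run N s f C \<sigma> srv d 0 = return (outputs 0) (\<lambda>_. undefined)"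
| "dp_sgd_run N s f C \<sigma> srv d (Suc i) =
     dp_sgd_run N s f C \<sigma> srv d i \<bind> (\<lambda>U.
       client_round f C \<sigma> (real (s i) / real N) d (srv i U) \<bind> (\<lambda>u.
         return (outputs (Suc i)) (U(i := u))))"

text \<open>All server-side randomness and all server-side data independent of \<open>d\<close> form a single random
  element \<open>\<omega>\<close> with law \<open>R\<close>, which the server may use in every round.  It is drawn independently of the
  client's sampling and noise; given \<open>\<omega>\<close> the server is deterministic.\<close>

definition server_behaviour ::
    "'r measure \<Rightarrow> ('r \<Rightarrow> nat \<Rightarrow> (nat \<Rightarrow> real^'m) \<Rightarrow> real^'m) \<Rightarrow> bool" where
  "server_behaviour R server \<longleftrightarrow> prob_space R \<and>
     (\<forall>i. (\<lambda>(\<omega>, U). server \<omega> i U) \<in> borel_measurable (R \<Otimes>\<^sub>M outputs i))"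

text \<open>For \<open>f\<close> differentiable in the model, \<open>loss_grad f\<close> is automatically Borel measurable in the model, being a
  limit of difference quotients; so all kernels bound here are measurable and \<open>dp_sgd\<close> is a genuine
  probability measure on \<open>outputs T\<close>.\<close>

definition dp_sgd ::
    "nat \<Rightarrow> nat \<Rightarrow> (nat \<Rightarrow> nat) \<Rightarrow> real \<Rightarrow> real \<Rightarrow> (real^'m \<Rightarrow> 'x \<Rightarrow> real)
      \<Rightarrow> 'r measure \<Rightarrow> ('r \<Rightarrow> nat \<Rightarrow> (nat \<Rightarrow> real^'m) \<Rightarrow> real^'m) \<Rightarrow> 'x set
      \<Rightarrow> (nat \<Rightarrow> real^'m) measure" where
  "dp_sgd N T s C \<sigma> f R server d =
     R \<bind> (\<lambda>\<omega>. dp_sgd_run N s f C \<sigma> (server \<omega>) d T)"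

definition gamma_admissible :: "real \<Rightarrow> real \<Rightarrow> real \<Rightarrow> real \<Rightarrow> bool" where
  "gamma_admissible \<epsilon> k \<sigma> \<gamma> \<longleftrightarrow>
     (let a = \<epsilon> / (\<gamma> * k) in
       \<gamma> > 0 \<and> a < 1 \<and> \<sigma> * (1 - a) - 2 * exp 1 * sqrt a > 0 \<and>
       \<gamma> \<ge> 2 / (1 - a)
          + 2 ^ 4 * a / (1 - a)
            * (\<sigma> / (1 - sqrt a)\<^sup>2
               + 1 / (\<sigma> * (1 - a) - 2 * exp 1 * sqrt a) * (exp 3 / \<sigma>))
            * exp (3 / \<sigma>\<^sup>2))"

end

theory Submission
  imports Defs
begin

text \<open>The privacy loss is controlled by its moment of order \<open>\<lambda> = \<sigma>\<^sup>2\<close>. In one round, the output laws on two adjacent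
  data sets are mixtures, over the sample drawn from the common elements, of a Gaussian \<open>G\<close> and of
  \<open>(1 - q) G + q G\<^sub>v\<close>, where \<open>q = s\<^sub>i / N\<close> and \<open>G\<^sub>v\<close> is \<open>G\<close> shifted by a clipped gradient \<open>v\<close>. A second-order Taylor
  expansion bounds the \<open>(\<lambda> + 1)\<close>-st moment of the density ratio, in both directions, by
  \<open>1 + \<lambda> (\<lambda> + 1) / 2 \<cdot> q\<^sup>2 \<cdot> \<kappa> / \<sigma>\<^sup>2\<close>, where \<open>\<kappa> \<le> 2 + 16 \<alpha> \<sigma> \<le> \<gamma>\<close> as soon as \<open>q \<le> \<alpha> = \<epsilon> / (\<gamma> k)\<close>. The moments multiply over
  the rounds. Since \<open>q \<le> \<theta> k / T\<close>, the condition on \<open>T\<close> gives both \<open>q \<le> \<alpha>\<close> and \<open>\<Sum> q\<^sup>2 \<le> \<epsilon> / \<gamma>\<close>, so the total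
  logarithmic moment is at most \<open>(\<sigma>\<^sup>2 + 1) \<epsilon> / 2 \<le> \<lambda> \<epsilon> - ln (1 / \<delta>)\<close>, and Hoelder's inequality against the indicator of an output set concludes.\<close>

section \<open>The density of one round\<close>

text \<open>Taylor expansion at 1 with Lagrange remainder: the second derivative is taken at some
  \<open>t\<close> between \<open>y\<close> and 1. Since \<open>t powr (m - 2)\<close> is monotone
  in \<open>t\<close>, it is at most the larger of its values at 1 and \<open>y\<close>;
  \<open>m * (m - 1) \<ge> 0\<close> lets that bound replace it.\<close>

lemma powr_le_second_order:
  fixes y m :: real
  assumes y: "y > 0" and m: "m * (m - 1) \<ge> 0"
  shows "y powr m \<le> 1 + m * (y - 1) + m * (m - 1) / 2 * (y - 1)\<^sup>2 * max 1 (y powr (m - 2))"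
proof (cases "y = 1")
  case False
  define D where "D = (\<lambda>(n :: nat) (x :: real). if n = 0 then x powr m else if n = 1 then m * x powr (m - 1)
    else m * (m - 1) * x powr (m - 2))"
  have "\<exists>t. (if y < 1 then y < t \<and> t < 1 else 1 < t \<and> t < y) \<and>
      y powr m = (\<Sum>i<2. D i 1 / fact i * (y - 1) ^ i) + D 2 t / fact 2 * (y - 1) ^ 2"
  proof (rule Taylor[of _ D "\<lambda>x. x powr m" "min y 1" "max y 1"])
    show "\<forall>i t. i < 2 \<and> min y 1 \<le> t \<and> t \<le> max y 1 \<longrightarrow> DERIV (D i) t :> D (Suc i) t"
    proof (intro allI impI)
      fix i :: nat and t assume *: "i < 2 \<and> min y 1 \<le> t \<and> t \<le> max y 1"
      have t: "t > 0" using * y by auto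
      show "DERIV (D i) t :> D (Suc i) t"
      proof (cases "i = 0")
        case True
        have "((\<lambda>x. x powr m) has_real_derivative m * t powr (m - 1)) (at t)"
          using t by (auto intro!: derivative_eq_intros)
        then show ?thesis using True by (simp add: D_def)
      next
        case False
        have "((\<lambda>x. m * x powr (m - 1)) has_real_derivative m * ((m - 1) * t powr (m - 1 - 1))) (at t)"
          using t by (auto intro!: derivative_eq_intros)
        then show ?thesis using False * by (simp add: D_def algebra_simps)
      qed
    qed
  qed (use False in \<open>auto simp: D_def fun_eq_iff\<close>)
  then obtain t where t: "if y < 1 then y < t \<and> t < 1 else 1 < t \<and> t < y"
    and eq: "y powr m = (\<Sum>i<2. D i 1 / fact i * (y - 1) ^ i) + D 2 t / fact 2 * (y - 1) ^ 2"
    by blast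
  have eq': "y powr m = 1 + m * (y - 1) + m * (m - 1) / 2 * (y - 1)\<^sup>2 * t powr (m - 2)"
    unfolding eq by (simp add: D_def numeral_2_eq_2)
  have t0: "t > 0" using t y by (auto split: if_splits)
  have "t powr (m - 2) \<le> max 1 (y powr (m - 2))"
  proof (cases "y < 1")
    case True
    show ?thesis
    proof (cases "m \<ge> 2")
      case True
      then have "t powr (m - 2) \<le> 1 powr (m - 2)"
        using t t0 \<open>y < 1\<close> by (intro powr_mono2) auto
      then show ?thesis by simp
    next
      case False
      then have "t powr (m - 2) \<le> y powr (m - 2)"
        using t t0 y \<open>y < 1\<close> by (intro powr_mono2') auto
      then show ?thesis by simp
    qed
  next
    case False
    show ?thesis
    proof (cases "m \<ge> 2")
      case True
      then have "t powr (m - 2) \<le> y powr (m - 2)"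
        using t t0 False by (intro powr_mono2) auto
      then show ?thesis by simp
    next
      case False
      then have "t powr (m - 2) \<le> 1 powr (m - 2)"
        using t t0 y \<open>\<not> y < 1\<close> by (intro powr_mono2') auto
      then show ?thesis by simp
    qed
  qed
  then show ?thesis unfolding eq' using m
    by (intro add_left_mono mult_left_mono) auto
qed auto

lemma mix_exp_pos:
  fixes q u :: real
  assumes "0 \<le> q" "q < 1"
  shows "1 + q * (exp u - 1) > 0"
proof -
  have "q * exp u \<ge> 0" using assms by simp
  then have "q < 1 + q * exp u" using assms by linarith
  then show ?thesis by (simp add: algebra_simps)
qed

text \<open>Jensen's inequality for \<open>exp\<close> and a Bernoulli variable with value
  \<open>u\<close> with probability \<open>q\<close> and 0 otherwise.\<close>

lemma ln_mix_exp_ge: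
  fixes q u :: real
  assumes "0 \<le> q" "q < 1"
  shows "q * u \<le> ln (1 + q * (exp u - 1))"
proof -
  have "exp ((1 - q) * 0 + q * u) \<le> (1 - q) * exp 0 + q * exp u"
    using convex_onD[OF exp_convex, of q 0 u] assms by simp
  then have "exp (q * u) \<le> 1 + q * (exp u - 1)" by (simp add: algebra_simps)
  then show ?thesis using mix_exp_pos[OF assms] by (simp add: ln_ge_iff)
qed

text \<open>Hoeffding's lemma for the same Bernoulli variable. A negative \<open>u\<close> is
  reduced to \<open>- u\<close> by pulling out \<open>exp u\<close>, which exchanges
  \<open>q\<close> and \<open>1 - q\<close>.\<close>

lemma ln_mix_exp_le:
  fixes q u :: real
  assumes "0 \<le> q" "q < 1"
  shows "ln (1 + q * (exp u - 1)) \<le> q * u + u\<^sup>2 / 8"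
proof (cases "u \<ge> 0")
  case True
  then show ?thesis using Hoeffdings_lemma_aux[of u q] assms by (simp add: algebra_simps)
next
  case False
  have "1 + q * (exp u - 1) = exp u * (1 + (1 - q) * (exp (- u) - 1))"
    by (simp add: algebra_simps flip: exp_add)
  then have "ln (1 + q * (exp u - 1)) = u + ln (1 + (1 - q) * (exp (- u) - 1))"
    using mix_exp_pos[OF assms, of u] by (simp add: ln_mult zero_less_mult_iff)
  then show ?thesis using Hoeffdings_lemma_aux[of "- u" "1 - q"] assms False
    by (simp add: algebra_simps)
qed

text \<open>Here \<open>1 + q (e\<^bsup>u\<^esup> - 1)\<close> is the density of a round on the larger data set relative to the smaller one;
  the exponents \<open>\<sigma>\<^sup>2 + 1\<close> and \<open>- \<sigma>\<^sup>2\<close> arise from the two directions of adjacency. The remainder of the Taylor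
  expansion is controlled by Hoeffding's bound \<open>q u \<le> ln (1 + q (e\<^bsup>u\<^esup> - 1)) \<le> q u + u\<^sup>2 / 8\<close>.\<close>

lemma mix_exp_powr_le:
  fixes q u m \<sigma> :: real
  assumes q: "0 \<le> q" "q < 1" and \<sigma>: "\<sigma> \<ge> 1" and m: "m = \<sigma>\<^sup>2 + 1 \<or> m = - \<sigma>\<^sup>2"
  shows "(1 + q * (exp u - 1)) powr m \<le> 1 + m * q * (exp u - 1)
    + \<sigma>\<^sup>2 * (\<sigma>\<^sup>2 + 1) / 2 * q\<^sup>2 * exp ((\<sigma> + 2 / \<sigma>) * q / 2)
      * ((exp u - 1)\<^sup>2 * exp (((\<sigma> + 2 / \<sigma>) * q + 1 / 4) * (\<sigma>\<^sup>2 * u\<^sup>2) / 2))"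
proof -
  define y where "y = 1 + q * (exp u - 1)"
  \<comment> \<open>Scaled so that \<open>X * \<sigma> = (\<sigma>^2 + 2) * q\<close>. The square
    \<open>X * (1 - \<sigma> * \<bar>u\<bar>)^2 \<ge> 0\<close> then trades the term linear in
    \<open>\<bar>u\<bar>\<close> for a constant and a quadratic term, which a Gaussian integral can
    absorb.\<close>
  define X where "X = (\<sigma> + 2 / \<sigma>) * q"
  have y: "y > 0" using mix_exp_pos[OF q] by (simp add: y_def)
  have lo: "q * u \<le> ln y" and hi: "ln y \<le> q * u + u\<^sup>2 / 8"
    using ln_mix_exp_ge[OF q] ln_mix_exp_le[OF q] by (auto simp: y_def)
  have mm: "m * (m - 1) = \<sigma>\<^sup>2 * (\<sigma>\<^sup>2 + 1)" using m by (auto simp: algebra_simps)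
  have s1: "\<sigma>\<^sup>2 \<ge> 1" using \<sigma> by simp
  have X0: "X \<ge> 0" using q \<sigma> by (simp add: X_def)
  have qu: "(\<sigma>\<^sup>2 + 2) * (q * \<bar>u\<bar>) \<le> X / 2 + X * (\<sigma>\<^sup>2 * u\<^sup>2) / 2"
  proof -
    have "0 \<le> X * (1 - \<sigma> * \<bar>u\<bar>)\<^sup>2" using X0 by simp
    then have "2 * (X * \<sigma> * \<bar>u\<bar>) \<le> X + X * (\<sigma>\<^sup>2 * u\<^sup>2)"
      by (simp add: power2_eq_square algebra_simps)
    moreover have "X * \<sigma> * \<bar>u\<bar> = (\<sigma>\<^sup>2 + 2) * (q * \<bar>u\<bar>)"
      using \<sigma> by (simp add: X_def field_simps power2_eq_square)
    ultimately show ?thesis by simp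
  qed
  \<comment> \<open>The two exponents call for opposite halves of Hoeffding's bound:
    \<open>m - 2 = \<sigma>^2 - 1\<close> is nonnegative and uses \<open>hi\<close>, while
    \<open>m - 2 = - (\<sigma>^2 + 2)\<close> is negative and uses \<open>lo\<close>. The right-hand
    side covers both.\<close>
  have e: "(m - 2) * ln y \<le> (\<sigma>\<^sup>2 + 2) * (q * \<bar>u\<bar>) + \<sigma>\<^sup>2 * u\<^sup>2 / 8"
    using m
  proof
    assume m: "m = \<sigma>\<^sup>2 + 1"
    have "(m - 2) * ln y \<le> (m - 2) * (q * \<bar>u\<bar> + u\<^sup>2 / 8)"
      using m s1 hi mult_left_mono[OF abs_ge_self[of u], of q] q
      by (intro mult_left_mono) auto
    also have "\<dots> \<le> (\<sigma>\<^sup>2 + 2) * (q * \<bar>u\<bar>) + \<sigma>\<^sup>2 * (u\<^sup>2 / 8)"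
      unfolding distrib_left using m s1 q by (intro add_mono mult_right_mono) auto
    finally show ?thesis by simp
  next
    assume m: "m = - \<sigma>\<^sup>2"
    have "- ln y \<le> q * \<bar>u\<bar>"
      using lo mult_left_mono[OF abs_ge_minus_self[of u], of q] q by simp
    then have "(\<sigma>\<^sup>2 + 2) * (- ln y) \<le> (\<sigma>\<^sup>2 + 2) * (q * \<bar>u\<bar>)"
      using s1 by (intro mult_left_mono) auto
    moreover have "(m - 2) * ln y = (\<sigma>\<^sup>2 + 2) * (- ln y)" by (simp add: m algebra_simps)
    moreover have "0 \<le> \<sigma>\<^sup>2 * u\<^sup>2 / 8" by simp
    ultimately show ?thesis by linarith
  qed
  have "max 1 (y powr (m - 2)) \<le> exp (X / 2 + (X + 1 / 4) * (\<sigma>\<^sup>2 * u\<^sup>2) / 2)"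
  proof -
    have "y powr (m - 2) \<le> exp (X / 2 + (X + 1 / 4) * (\<sigma>\<^sup>2 * u\<^sup>2) / 2)"
    proof -
      have "(m - 2) * ln y \<le> X / 2 + (X + 1 / 4) * (\<sigma>\<^sup>2 * u\<^sup>2) / 2"
      proof -
        have "(X + 1 / 4) * V / 2 = X * V / 2 + V / 8" for V :: real
          by (simp add: field_simps)
        then have "(X + 1 / 4) * (\<sigma>\<^sup>2 * u\<^sup>2) / 2 = X * (\<sigma>\<^sup>2 * u\<^sup>2) / 2 + \<sigma>\<^sup>2 * u\<^sup>2 / 8" .
        then show ?thesis using e qu by linarith
      qed
      then show ?thesis using y by (simp add: powr_def)
    qed
    moreover have "1 \<le> exp (X / 2 + (X + 1 / 4) * (\<sigma>\<^sup>2 * u\<^sup>2) / 2)"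
      using X0 by simp
    ultimately show ?thesis by simp
  qed
  then have "m * (m - 1) / 2 * (y - 1)\<^sup>2 * max 1 (y powr (m - 2))
      \<le> m * (m - 1) / 2 * (y - 1)\<^sup>2 * exp (X / 2 + (X + 1 / 4) * (\<sigma>\<^sup>2 * u\<^sup>2) / 2)"
    unfolding mm by (intro mult_left_mono) auto
  with powr_le_second_order[OF y, of m]
  have "y powr m \<le> 1 + m * (y - 1) + m * (m - 1) / 2 * (y - 1)\<^sup>2
      * exp (X / 2 + (X + 1 / 4) * (\<sigma>\<^sup>2 * u\<^sup>2) / 2)"
    unfolding mm by simp
  then show ?thesis
    unfolding mm exp_add by (simp add: y_def X_def power_mult_distrib mult_ac)
qed

section \<open>Gaussian integrals of exponentials of quadratic polynomials\<close>

text \<open>Completing the square: the quadratic weight changes the variance from \<open>r^2\<close>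
  to \<open>r^2 / (1 - b)\<close>, and \<open>b < 1\<close> keeps the result a Gaussian. Mean
  \<open>- r^2 / 2\<close> and variance \<open>r^2\<close> are those of the log density ratio of two
  Gaussians whose centres are \<open>r\<close> standard deviations apart.\<close>

lemma normal_density_mult_exp_quadratic:
  fixes r b c u :: real
  assumes r: "r > 0" and b: "b < 1"
  defines "\<rho> \<equiv> r / sqrt (1 - b)"
  shows "normal_density (- r\<^sup>2 / 2) r u * exp (c * u + b * u\<^sup>2 / (2 * r\<^sup>2))
    = \<rho> / r * exp ((c - 1 / 2)\<^sup>2 * \<rho>\<^sup>2 / 2 - r\<^sup>2 / 8) * normal_density ((c - 1 / 2) * \<rho>\<^sup>2) \<rho> u"
proof -
  define \<beta> where "\<beta> = 1 - b"
  have \<beta>: "\<beta> > 0" "b = 1 - \<beta>" using b by (auto simp: \<beta>_def)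
  have \<rho>: "\<rho> > 0" using r b by (simp add: \<rho>_def)
  have r2: "r\<^sup>2 = \<beta> * \<rho>\<^sup>2" using b by (simp add: \<rho>_def \<beta>_def power_divide)
  have "- (u - - r\<^sup>2 / 2)\<^sup>2 / (2 * r\<^sup>2) + (c * u + b * u\<^sup>2 / (2 * r\<^sup>2))
    = ((c - 1 / 2)\<^sup>2 * \<rho>\<^sup>2 / 2 - r\<^sup>2 / 8) + - (u - (c - 1 / 2) * \<rho>\<^sup>2)\<^sup>2 / (2 * \<rho>\<^sup>2)"
    unfolding r2 \<beta>(2) using \<beta>(1) \<rho> by (simp add: field_simps power2_eq_square)
  then have "exp (- (u - - r\<^sup>2 / 2)\<^sup>2 / (2 * r\<^sup>2)) * exp (c * u + b * u\<^sup>2 / (2 * r\<^sup>2))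
    = exp ((c - 1 / 2)\<^sup>2 * \<rho>\<^sup>2 / 2 - r\<^sup>2 / 8) * exp (- (u - (c - 1 / 2) * \<rho>\<^sup>2)\<^sup>2 / (2 * \<rho>\<^sup>2))"
    unfolding exp_add[symmetric] by simp
  moreover have "1 / sqrt (2 * pi * r\<^sup>2) = \<rho> / r * (1 / sqrt (2 * pi * \<rho>\<^sup>2))"
    using r \<rho> by (simp add: real_sqrt_mult)
  ultimately show ?thesis unfolding normal_density_def by (simp add: mult_ac)
qed

lemma has_bochner_integral_normal_exp_quadratic:
  fixes r b c :: real
  assumes r: "r > 0" and b: "b < 1"
  defines "\<rho> \<equiv> r / sqrt (1 - b)"
  shows "has_bochner_integral lborel
    (\<lambda>u. normal_density (- r\<^sup>2 / 2) r u * exp (c * u + b * u\<^sup>2 / (2 * r\<^sup>2)))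
    (\<rho> / r * exp ((c - 1 / 2)\<^sup>2 * \<rho>\<^sup>2 / 2 - r\<^sup>2 / 8))"
proof -
  have \<rho>: "\<rho> > 0" using r b by (simp add: \<rho>_def)
  have "has_bochner_integral lborel (normal_density ((c - 1 / 2) * \<rho>\<^sup>2) \<rho>) 1"
    using \<rho> by (simp add: has_bochner_integral_iff)
  then have "has_bochner_integral lborel
      (\<lambda>u. \<rho> / r * exp ((c - 1 / 2)\<^sup>2 * \<rho>\<^sup>2 / 2 - r\<^sup>2 / 8) * normal_density ((c - 1 / 2) * \<rho>\<^sup>2) \<rho> u)
      (\<rho> / r * exp ((c - 1 / 2)\<^sup>2 * \<rho>\<^sup>2 / 2 - r\<^sup>2 / 8) * 1)"
    by (intro has_bochner_integral_mult_right)
  then show ?thesis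
    unfolding normal_density_mult_exp_quadratic[OF r b] \<rho>_def by simp
qed

lemma has_bochner_integral_normal_exp:
  fixes r :: real
  assumes "r > 0"
  shows "has_bochner_integral lborel (\<lambda>u. normal_density (- r\<^sup>2 / 2) r u * exp u) 1"
  using has_bochner_integral_normal_exp_quadratic[OF assms, of 0 1] assms
  by (simp add: power2_eq_square)

text \<open>Expanding the square gives the exponents \<open>c = 2, 1, 0\<close>. The last two have
  the same integral because \<open>(c - 1/2)^2\<close> agrees, so only the difference of two terms
  remains. At \<open>b = 0\<close> the value is the chi-square divergence
  \<open>exp (r^2) - 1\<close>.\<close>

lemma has_bochner_integral_normal_chi_square:
  fixes r b :: real
  assumes r: "r > 0" and b: "b < 1"
  defines "\<rho> \<equiv> r / sqrt (1 - b)"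
  shows "has_bochner_integral lborel
    (\<lambda>u. normal_density (- r\<^sup>2 / 2) r u * ((exp u - 1)\<^sup>2 * exp (b * u\<^sup>2 / (2 * r\<^sup>2))))
    (\<rho> / r * exp ((\<rho>\<^sup>2 - r\<^sup>2) / 8) * (exp (\<rho>\<^sup>2) - 1))"
proof -
  note I = has_bochner_integral_normal_exp_quadratic[OF r b, folded \<rho>_def]
  have "has_bochner_integral lborel
     (\<lambda>u. normal_density (- r\<^sup>2 / 2) r u * exp (2 * u + b * u\<^sup>2 / (2 * r\<^sup>2))
        - 2 * (normal_density (- r\<^sup>2 / 2) r u * exp (1 * u + b * u\<^sup>2 / (2 * r\<^sup>2)))
        + normal_density (- r\<^sup>2 / 2) r u * exp (0 * u + b * u\<^sup>2 / (2 * r\<^sup>2)))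
     (\<rho> / r * exp ((2 - 1 / 2)\<^sup>2 * \<rho>\<^sup>2 / 2 - r\<^sup>2 / 8)
        - 2 * (\<rho> / r * exp ((1 - 1 / 2)\<^sup>2 * \<rho>\<^sup>2 / 2 - r\<^sup>2 / 8))
        + \<rho> / r * exp ((0 - 1 / 2)\<^sup>2 * \<rho>\<^sup>2 / 2 - r\<^sup>2 / 8))"
    by (intro has_bochner_integral_add has_bochner_integral_diff has_bochner_integral_mult_right I)
  also have "(\<lambda>u. normal_density (- r\<^sup>2 / 2) r u * exp (2 * u + b * u\<^sup>2 / (2 * r\<^sup>2))
        - 2 * (normal_density (- r\<^sup>2 / 2) r u * exp (1 * u + b * u\<^sup>2 / (2 * r\<^sup>2)))
        + normal_density (- r\<^sup>2 / 2) r u * exp (0 * u + b * u\<^sup>2 / (2 * r\<^sup>2)))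
     = (\<lambda>u. normal_density (- r\<^sup>2 / 2) r u * ((exp u - 1)\<^sup>2 * exp (b * u\<^sup>2 / (2 * r\<^sup>2))))"
    unfolding exp_add exp_double by (simp add: algebra_simps power2_eq_square)
  also have "\<rho> / r * exp ((2 - 1 / 2)\<^sup>2 * \<rho>\<^sup>2 / 2 - r\<^sup>2 / 8)
        - 2 * (\<rho> / r * exp ((1 - 1 / 2)\<^sup>2 * \<rho>\<^sup>2 / 2 - r\<^sup>2 / 8))
        + \<rho> / r * exp ((0 - 1 / 2)\<^sup>2 * \<rho>\<^sup>2 / 2 - r\<^sup>2 / 8)
     = \<rho> / r * exp ((\<rho>\<^sup>2 - r\<^sup>2) / 8) * (exp (\<rho>\<^sup>2) - 1)"
  proof -
    have "(2 - 1 / 2)\<^sup>2 * \<rho>\<^sup>2 / 2 - r\<^sup>2 / 8 = (\<rho>\<^sup>2 - r\<^sup>2) / 8 + \<rho>\<^sup>2"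
      by (simp add: power2_eq_square field_simps)
    moreover have "(1 - 1 / 2)\<^sup>2 * \<rho>\<^sup>2 / 2 - r\<^sup>2 / 8 = (\<rho>\<^sup>2 - r\<^sup>2) / 8"
        "(0 - 1 / 2)\<^sup>2 * \<rho>\<^sup>2 / 2 - r\<^sup>2 / 8 = (\<rho>\<^sup>2 - r\<^sup>2) / 8"
      by (simp_all add: power2_eq_square field_simps)
    moreover have "a * (E * F) - 2 * (a * E) + a * E = a * E * (F - 1)" for a E F :: real
      by (simp add: algebra_simps)
    ultimately show ?thesis by (simp only: exp_add)
  qed
  finally show ?thesis .
qed

section \<open>Numerical bounds for the weighted chi-square integral\<close>

lemma exp_le_quadratic_bound:
  fixes h :: real
  assumes "0 \<le> z" "z \<le> h" "h \<le> 1"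
  shows "exp z \<le> 1 + h + h\<^sup>2"
proof -
  have "exp z \<le> exp h" using assms by simp
  also have "\<dots> \<le> 1 + h + h\<^sup>2" using assms by (intro exp_bound) auto
  finally show ?thesis .
qed

text \<open>Arithmetic shared by the two ranges of \<open>x\<close> distinguished below. Here
  \<open>\<beta>\<close> stands for \<open>1 - b\<close>, with lower bounds \<open>\<beta>0\<close>
  for it and \<open>s0\<close> for its square root, and \<open>h\<close> bounds
  \<open>X / 2\<close>. The factor 1.06 absorbs \<open>1.0065 * 1.0512\<close>, the losses from the
  two exponentials in \<open>\<rho>^2\<close>.\<close>

lemma chi_square_weight_numeric:
  fixes h \<beta> \<beta>0 s0 r X M :: real
  assumes r: "0 < r" "r\<^sup>2 \<le> 1 / 34" and X: "0 \<le> X" "X \<le> 2 * h" and h: "h \<le> 1"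
    and \<beta>: "\<beta>0 \<le> \<beta>" "0.575 \<le> \<beta>0" and s0: "0 < s0" "s0\<^sup>2 \<le> \<beta>0"
    and M: "(1 + h + h\<^sup>2) * 1.06 \<le> M * (s0 * \<beta>0)" and \<rho>: "\<rho> = r / sqrt \<beta>"
  shows "exp (X / 2) * (\<rho> / r * exp ((\<rho>\<^sup>2 - r\<^sup>2) / 8) * (exp (\<rho>\<^sup>2) - 1)) \<le> M * r\<^sup>2"
proof -
  have \<beta>pos: "\<beta> > 0" using \<beta> by simp
  have \<rho>2: "\<rho>\<^sup>2 = r\<^sup>2 / \<beta>" using \<beta>pos by (simp add: \<rho> power_divide)
  have "\<rho>\<^sup>2 \<le> (1 / 34) / 0.575"
    unfolding \<rho>2 using r \<beta> by (intro frac_le) auto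
  then have z: "\<rho>\<^sup>2 \<le> 0.0512" by simp
  have e1: "exp (X / 2) \<le> 1 + h + h\<^sup>2" using X h by (intro exp_le_quadratic_bound) auto
  have e2: "exp ((\<rho>\<^sup>2 - r\<^sup>2) / 8) \<le> 1.0065"
  proof -
    have "exp ((\<rho>\<^sup>2 - r\<^sup>2) / 8) \<le> exp (\<rho>\<^sup>2 / 8)" by simp
    also have "\<dots> \<le> 1 + 0.0064 + 0.0064\<^sup>2" using z by (intro exp_le_quadratic_bound) auto
    also have "\<dots> \<le> 1.0065" by (simp add: power2_eq_square)
    finally show ?thesis .
  qed
  have e3: "exp (\<rho>\<^sup>2) - 1 \<le> 1.0512 * \<rho>\<^sup>2"
  proof -
    have "exp (\<rho>\<^sup>2) \<le> 1 + \<rho>\<^sup>2 + \<rho>\<^sup>2 * \<rho>\<^sup>2" using exp_bound[of "\<rho>\<^sup>2"] z by (simp add: power2_eq_square)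
    moreover have "\<rho>\<^sup>2 * \<rho>\<^sup>2 \<le> 0.0512 * \<rho>\<^sup>2" using z by (intro mult_right_mono) auto
    ultimately show ?thesis by simp
  qed
  have s: "s0 \<le> sqrt \<beta>" using \<beta> s0 by (simp add: real_le_rsqrt)
  have "\<rho> / r = 1 / sqrt \<beta>" using r by (simp add: \<rho>)
  also have "\<dots> \<le> 1 / s0" using s s0 by (simp add: frac_le)
  finally have e4: "\<rho> / r \<le> 1 / s0" .
  have e5: "\<rho>\<^sup>2 \<le> r\<^sup>2 / \<beta>0" unfolding \<rho>2 using \<beta> by (intro divide_left_mono) auto
  have "\<rho> / r * exp ((\<rho>\<^sup>2 - r\<^sup>2) / 8) * (exp (\<rho>\<^sup>2) - 1) \<le> 1 / s0 * 1.0065 * (1.0512 * (r\<^sup>2 / \<beta>0))"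
  proof (intro mult_mono e4 e2)
    show "exp (\<rho>\<^sup>2) - 1 \<le> 1.0512 * (r\<^sup>2 / \<beta>0)"
      proof -
        have "1.0512 * \<rho>\<^sup>2 \<le> 1.0512 * (r\<^sup>2 / \<beta>0)" using e5 by (rule mult_left_mono) simp
        then show ?thesis using e3 by (rule order_trans[rotated])
      qed
  qed (use s0 in auto)
  also have "\<dots> \<le> 1.06 * r\<^sup>2 / (s0 * \<beta>0)"
    using s0 \<beta> by (simp add: field_simps)
  finally have "exp (X / 2) * (\<rho> / r * exp ((\<rho>\<^sup>2 - r\<^sup>2) / 8) * (exp (\<rho>\<^sup>2) - 1))
      \<le> (1 + h + h\<^sup>2) * (1.06 * r\<^sup>2 / (s0 * \<beta>0))"
    using r \<beta>pos X h by (intro mult_mono[OF e1]) (auto simp: \<rho> intro!: mult_nonneg_nonneg add_nonneg_nonneg)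
  also have "\<dots> = ((1 + h + h\<^sup>2) * 1.06) * (r\<^sup>2 / (s0 * \<beta>0))" by simp
  also have "\<dots> \<le> (M * (s0 * \<beta>0)) * (r\<^sup>2 / (s0 * \<beta>0))"
    using M s0 \<beta> by (intro mult_right_mono) auto
  also have "\<dots> = M * r\<^sup>2" using s0 \<beta> by simp
  finally show ?thesis .
qed

text \<open>As \<open>\<sigma>^2 \<ge> 34\<close>, the quantity \<open>X\<close> exceeds
  \<open>q * \<sigma>\<close> by a factor of at most \<open>1 + 2 / 34 = 18 / 17\<close>, so
  \<open>x < 0.165\<close> keeps the Gaussian weight well below the critical value 1.\<close>

lemma chi_square_weight_bound:
  fixes q \<sigma> x \<gamma> r :: real
  assumes x: "x < 0.165" and \<sigma>: "\<sigma> > 0" "\<sigma>\<^sup>2 \<ge> 34" and q: "0 \<le> q" "q * \<sigma> \<le> x"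
    and r: "0 < r" "r \<le> 1 / \<sigma>" and \<gamma>: "\<gamma> \<ge> 2 + 16 * x"
  defines "X \<equiv> (\<sigma> + 2 / \<sigma>) * q"
  defines "\<rho> \<equiv> r / sqrt (1 - (X + 1 / 4))"
  shows "X + 1 / 4 < 1"
    and "exp (X / 2) * (\<rho> / r * exp ((\<rho>\<^sup>2 - r\<^sup>2) / 8) * (exp (\<rho>\<^sup>2) - 1)) \<le> \<gamma> / \<sigma>\<^sup>2"
proof -
  have x0: "x \<ge> 0" using q \<sigma> by (meson mult_nonneg_nonneg less_imp_le order_trans)
  have "X = q * \<sigma> * (1 + 2 / \<sigma>\<^sup>2)" using \<sigma> by (simp add: X_def field_simps power2_eq_square)
  also have "\<dots> \<le> x * (1 + 2 / 34)"
    using q \<sigma> x0 by (intro mult_mono add_left_mono divide_left_mono) auto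
  finally have X: "X \<le> x * (18 / 17)" by simp
  have X0: "X \<ge> 0" using q \<sigma> by (simp add: X_def)
  show "X + 1 / 4 < 1" using X x by simp
  have r2: "r\<^sup>2 \<le> 1 / \<sigma>\<^sup>2"
    using power_mono[OF r(2), of 2] r by (simp add: power_divide)
  also have "\<dots> \<le> 1 / 34" using \<sigma> by (intro divide_left_mono) auto
  finally have r34: "r\<^sup>2 \<le> 1 / 34" .
  have "exp (X / 2) * (\<rho> / r * exp ((\<rho>\<^sup>2 - r\<^sup>2) / 8) * (exp (\<rho>\<^sup>2) - 1)) \<le> (2 + 16 * x) * r\<^sup>2"
  \<comment> \<open>For small \<open>x\<close> the constant 2 alone suffices. Beyond the threshold
    the worst case \<open>x = 0.165\<close> is bounded by 2.9, and \<open>2 + 16 * 0.0566\<close>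
    already exceeds 2.9.\<close>
  proof (cases "x \<le> 0.0566")
    case True
    have "exp (X / 2) * (\<rho> / r * exp ((\<rho>\<^sup>2 - r\<^sup>2) / 8) * (exp (\<rho>\<^sup>2) - 1)) \<le> 2 * r\<^sup>2"
      by (rule chi_square_weight_numeric[where h = "0.03" and ?\<beta>0.0 = "0.69" and ?s0.0 = "0.83"
            and \<beta> = "1 - (X + 1 / 4)"])
        (use r r34 X0 X True in \<open>auto simp: \<rho>_def power2_eq_square\<close>)
    also have "\<dots> \<le> (2 + 16 * x) * r\<^sup>2" using x0 by (intro mult_right_mono) auto
    finally show ?thesis .
  next
    case False
    have "exp (X / 2) * (\<rho> / r * exp ((\<rho>\<^sup>2 - r\<^sup>2) / 8) * (exp (\<rho>\<^sup>2) - 1)) \<le> 2.9 * r\<^sup>2"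
      by (rule chi_square_weight_numeric[where h = "0.0875" and ?\<beta>0.0 = "0.575" and ?s0.0 = "0.758"
            and \<beta> = "1 - (X + 1 / 4)"])
        (use r r34 X0 X x in \<open>auto simp: \<rho>_def power2_eq_square\<close>)
    also have "\<dots> \<le> (2 + 16 * x) * r\<^sup>2" using False by (intro mult_right_mono) auto
    finally show ?thesis .
  qed
  also have "\<dots> \<le> \<gamma> * (1 / \<sigma>\<^sup>2)" using r2 \<gamma> x0 by (intro mult_mono) auto
  finally show "exp (X / 2) * (\<rho> / r * exp ((\<rho>\<^sup>2 - r\<^sup>2) / 8) * (exp (\<rho>\<^sup>2) - 1)) \<le> \<gamma> / \<sigma>\<^sup>2"
    by simp
qed

section \<open>Hoelder domination\<close>

text \<open>Convexity of \<open>exp\<close> at the points \<open>p * ln u\<close> and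
  \<open>q * ln v\<close> with weights \<open>1 / p\<close> and \<open>1 / q\<close>.\<close>

lemma young_powr:
  fixes u v p q :: real
  assumes "u \<ge> 0" "v \<ge> 0" "p > 1" "q > 1" "1 / p + 1 / q = 1"
  shows "u * v \<le> u powr p / p + v powr q / q"
proof (cases "u = 0 \<or> v = 0")
  case False
  with assms have uv: "u > 0" "v > 0" by auto
  have p: "1 / p = 1 - 1 / q" using assms by simp
  have "exp ((1 - 1 / q) * (p * ln u) + 1 / q * (q * ln v))
      \<le> (1 - 1 / q) * exp (p * ln u) + 1 / q * exp (q * ln v)"
    using convex_onD[OF exp_convex, of "1 / q" "p * ln u" "q * ln v"] assms by simp
  moreover have "(1 - 1 / q) * (p * ln u) + 1 / q * (q * ln v) = ln (u * v)"
    unfolding p[symmetric] using assms uv by (simp add: ln_mult)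
  ultimately show ?thesis unfolding p[symmetric] using uv by (simp add: powr_def)
qed (use assms in auto)

text \<open>Hoelder's inequality from Young's, after scaling both functions to unit norm. If one
  norm vanishes, the product is zero almost everywhere.\<close>

lemma
  fixes f g :: "'a \<Rightarrow> real"
  assumes [measurable]: "f \<in> borel_measurable M" "g \<in> borel_measurable M"
    and nonneg: "\<And>x. x \<in> space M \<Longrightarrow> 0 \<le> f x" "\<And>x. x \<in> space M \<Longrightarrow> 0 \<le> g x"
    and pq: "p > 1" "q > 1" "1 / p + 1 / q = 1"
    and I: "integrable M (\<lambda>x. f x powr p)" "integrable M (\<lambda>x. g x powr q)"
  shows integrable_holder: "integrable M (\<lambda>x. f x * g x)"
    and integral_holder: "(\<integral>x. f x * g x \<partial>M)
      \<le> (\<integral>x. f x powr p \<partial>M) powr (1 / p) * (\<integral>x. g x powr q \<partial>M) powr (1 / q)"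
proof -
  have young: "f x * g x \<le> f x powr p / p + g x powr q / q" if "x \<in> space M" for x
    using that nonneg pq by (intro young_powr) auto
  show int: "integrable M (\<lambda>x. f x * g x)"
  proof (rule Bochner_Integration.integrable_bound)
    show "integrable M (\<lambda>x. f x powr p / p + g x powr q / q)" using I by auto
    show "AE x in M. norm (f x * g x) \<le> norm (f x powr p / p + g x powr q / q)"
      using young nonneg by (intro AE_I2) force
  qed simp
  define a where "a = (\<integral>x. f x powr p \<partial>M)"
  define b where "b = (\<integral>x. g x powr q \<partial>M)"
  have ab: "a \<ge> 0" "b \<ge> 0" by (simp_all add: a_def b_def)
  have "(\<integral>x. f x * g x \<partial>M) \<le> a powr (1 / p) * b powr (1 / q)"
  proof (cases "a = 0 \<or> b = 0")
    case True
    have "AE x in M. f x * g x = 0"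
      using True
    proof
      assume "a = 0"
      then have "AE x in M. f x powr p = 0"
        unfolding a_def using I by (subst (asm) integral_nonneg_eq_0_iff_AE) auto
      then show ?thesis by eventually_elim simp
    next
      assume "b = 0"
      then have "AE x in M. g x powr q = 0"
        unfolding b_def using I by (subst (asm) integral_nonneg_eq_0_iff_AE) auto
      then show ?thesis by eventually_elim simp
    qed
    then have "(\<integral>x. f x * g x \<partial>M) = 0" by (simp add: integral_eq_zero_AE)
    then show ?thesis by simp
  next
    case False
    with ab have ab: "a > 0" "b > 0" by auto
    define A where "A = a powr (1 / p)"
    define B where "B = b powr (1 / q)"
    have AB: "A > 0" "B > 0" "A powr p = a" "B powr q = b"
      using ab pq by (auto simp: A_def B_def powr_powr)
    have "(\<integral>x. f x * g x \<partial>M) / (A * B) = (\<integral>x. (f x / A) * (g x / B) \<partial>M)"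
      by simp
    also have "\<dots> \<le> (\<integral>x. f x powr p / (a * p) + g x powr q / (b * q) \<partial>M)"
    proof (rule integral_mono)
      fix x assume x: "x \<in> space M"
      have "(f x / A) * (g x / B) \<le> (f x / A) powr p / p + (g x / B) powr q / q"
        using x nonneg AB pq by (intro young_powr) auto
      also have "\<dots> = f x powr p / (a * p) + g x powr q / (b * q)"
        using x nonneg AB by (simp add: powr_divide)
      finally show "(f x / A) * (g x / B) \<le> f x powr p / (a * p) + g x powr q / (b * q)" .
    qed (use int I in auto)
    also have "\<dots> = a / (a * p) + b / (b * q)"
      using I by (simp add: a_def b_def)
    also have "\<dots> = 1" using ab pq by simp
    finally show ?thesis using AB by (simp add: A_def B_def)
  qed
  then show "(\<integral>x. f x * g x \<partial>M)
      \<le> (\<integral>x. f x powr p \<partial>M) powr (1 / p) * (\<integral>x. g x powr q \<partial>M) powr (1 / q)"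
    by (simp add: a_def b_def)
qed

text \<open>If \<open>P\<close> has density \<open>\<rho>\<close> relative to \<open>Q\<close>, this is the dual form of the moment bound
  \<open>\<integral> \<rho>\<^bsup>l + 1\<^esup> dQ \<le> B\<^bsup>l + 1\<^esup>\<close>. It composes along the Giry monad without any reference to joint densities.\<close>

definition holder_dominated :: "real \<Rightarrow> real \<Rightarrow> 'a measure \<Rightarrow> 'a measure \<Rightarrow> bool" where
  "holder_dominated l B P Q \<longleftrightarrow>
     (\<forall>g\<in>borel_measurable Q. (\<forall>x\<in>space Q. 0 \<le> g x \<and> g x \<le> 1) \<longrightarrow>
        (\<integral>x. g x \<partial>P) \<le> B * (\<integral>x. g x powr ((l + 1) / l) \<partial>Q) powr (l / (l + 1)))"

text \<open>Hoelder's inequality against the constant 1. It gives the factor 1 for everything that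
  has the same law on both data sets: the common sample, the server's randomness and the recording
  of an output.\<close>

lemma holder_dominated_refl:
  assumes "prob_space P" and l: "l > 0"
  shows "holder_dominated l 1 P P"
  unfolding holder_dominated_def
proof (intro ballI impI)
  interpret prob_space P by fact
  fix g :: "'a \<Rightarrow> real" assume g[measurable]: "g \<in> borel_measurable P"
    and b: "\<forall>x\<in>space P. 0 \<le> g x \<and> g x \<le> 1"
  have "(\<integral>x. g x * 1 \<partial>P) \<le> (\<integral>x. g x powr ((l + 1) / l) \<partial>P) powr (1 / ((l + 1) / l))
    * (\<integral>x. 1 powr (l + 1) \<partial>P) powr (1 / (l + 1))"
  proof (rule integral_holder)
    show "integrable P (\<lambda>x. g x powr ((l + 1) / l))"
      using b l by (intro integrable_const_bound[where B = 1]) (auto intro!: AE_I2 powr_le1)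
    show "1 / ((l + 1) / l) + 1 / (l + 1) = 1" using l by (simp add: field_simps)
  qed (use l b in \<open>auto simp: field_simps\<close>)
  then show "(\<integral>x. g x \<partial>P) \<le> 1 * (\<integral>x. g x powr ((l + 1) / l) \<partial>P) powr (l / (l + 1))"
    by (simp add: prob_space)
qed

lemma integral_bind_prob_algebra:
  fixes g :: "'b \<Rightarrow> real"
  assumes P: "P \<in> space (prob_algebra M)" and K: "K \<in> M \<rightarrow>\<^sub>M prob_algebra N"
    and g: "g \<in> borel_measurable N" and b: "\<And>x. x \<in> space N \<Longrightarrow> 0 \<le> g x \<and> g x \<le> 1"
  shows "(\<integral>y. g y \<partial>(P \<bind> K)) = (\<integral>x. (\<integral>y. g y \<partial>K x) \<partial>P)"
proof (rule integral_bind[OF g])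
  have sP: "sets P = sets M" "prob_space P" using P by (auto simp: space_prob_algebra)
  then interpret prob_space P by simp
  show "finite_measure P" by (rule finite_measure_axioms)
  show K': "K \<in> P \<rightarrow>\<^sub>M subprob_algebra N"
    using measurable_prob_algebraD[OF K] measurable_cong_sets[OF sP(1) refl] by blast
  show "AE x in P. emeasure (K x) (space (K x)) \<le> ennreal 1"
    by (intro AE_I2) (use subprob_space.emeasure_space_le_1[OF subprob_space_kernel[OF K']] in auto)
  show "\<bar>g x\<bar> \<le> 1" if "x \<in> space N" for x using b[OF that] by auto
qed

lemma prob_integral_unit:
  fixes g :: "'a \<Rightarrow> real"
  assumes "prob_space P" "g \<in> borel_measurable P" "\<And>x. x \<in> space P \<Longrightarrow> 0 \<le> g x \<and> g x \<le> 1"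
  shows "integrable P g" "0 \<le> (\<integral>x. g x \<partial>P)" "(\<integral>x. g x \<partial>P) \<le> 1"
proof -
  interpret prob_space P by fact
  show i: "integrable P g"
    using assms by (intro integrable_const_bound[where B = 1]) (auto intro!: AE_I2)
  show "0 \<le> (\<integral>x. g x \<partial>P)" using assms by (intro integral_nonneg_AE AE_I2) auto
  show "(\<integral>x. g x \<partial>P) \<le> 1" using assms i by (intro integral_le_const AE_I2) auto
qed

text \<open>Domination of the kernels bounds the inner integral of \<open>g\<close> by
  \<open>B2 * H x powr (1 / p)\<close>, where \<open>H\<close> is the inner integral of
  \<open>g powr p\<close>. That function again takes values in [0, 1], so it is a legitimate test
  function for \<open>P\<close> and \<open>Q\<close>, and its \<open>p\<close>-th power is
  \<open>H\<close>. The exponents cancel and the constants multiply.\<close>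

lemma holder_dominated_bind:
  assumes P: "P \<in> space (prob_algebra M)" and Q: "Q \<in> space (prob_algebra M)"
    and K: "K \<in> M \<rightarrow>\<^sub>M prob_algebra N" and K': "K' \<in> M \<rightarrow>\<^sub>M prob_algebra N"
    and PQ: "holder_dominated l B1 P Q"
    and KK': "\<And>x. x \<in> space M \<Longrightarrow> holder_dominated l B2 (K x) (K' x)"
    and l: "l > 0" and B2: "B2 \<ge> 0"
  shows "holder_dominated l (B1 * B2) (P \<bind> K) (Q \<bind> K')"
  unfolding holder_dominated_def
proof (intro ballI impI)
  have sP: "sets P = sets M" "space P = space M" "prob_space P"
    using P by (auto simp: space_prob_algebra dest: sets_eq_imp_space_eq)
  have sQ: "sets Q = sets M" "space Q = space M" "prob_space Q"
    using Q by (auto simp: space_prob_algebra dest: sets_eq_imp_space_eq)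
  have sK: "sets (K x) = sets N" "space (K x) = space N" "prob_space (K x)"
    and sK': "sets (K' x) = sets N" "space (K' x) = space N" "prob_space (K' x)"
    if "x \<in> space M" for x
    using measurable_space[OF K that] measurable_space[OF K' that]
    by (auto simp: space_prob_algebra dest: sets_eq_imp_space_eq)
  have sQK: "sets (Q \<bind> K') = sets N"
    using prob_space.not_empty[OF sQ(3)] sK' sQ by (intro sets_bind) auto
  have spQK: "space (Q \<bind> K') = space N" using sQK by (rule sets_eq_imp_space_eq)
  fix g :: "'b \<Rightarrow> real" assume g: "g \<in> borel_measurable (Q \<bind> K')"
    and b: "\<forall>x\<in>space (Q \<bind> K'). 0 \<le> g x \<and> g x \<le> 1"
  define p where "p = (l + 1) / l"
  have p: "p > 1" "l / (l + 1) = 1 / p" using l by (auto simp: p_def field_simps)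
  have g[measurable]: "g \<in> borel_measurable N" using g measurable_cong_sets[OF sQK refl] by auto
  have b: "0 \<le> g x \<and> g x \<le> 1" if "x \<in> space N" for x using b that spQK by auto
  have bp: "0 \<le> g x powr p \<and> g x powr p \<le> 1" if "x \<in> space N" for x
    using b[OF that] p by (auto intro: powr_le1)
  have gp: "(\<lambda>x. g x powr p) \<in> borel_measurable N" by simp
  have gK: "f \<in> borel_measurable (K x)" "f \<in> borel_measurable (K' x)"
    if "x \<in> space M" "f \<in> borel_measurable N" for x and f :: "'b \<Rightarrow> real"
    using that measurable_cong_sets[OF sK(1) refl, of x] measurable_cong_sets[OF sK'(1) refl, of x] by auto
  define H where "H = (\<lambda>x. \<integral>y. g y powr p \<partial>K' x)"
  have H[measurable]: "H \<in> borel_measurable M"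
    unfolding H_def
    by (rule measurable_compose[OF measurable_prob_algebraD[OF K'] integral_measurable_subprob_algebra[OF gp]])
  have H01: "0 \<le> H x" "H x \<le> 1" if "x \<in> space M" for x
    unfolding H_def
    using prob_integral_unit(2,3)[OF sK'(3)[OF that] gK(2)[OF that gp]] bp sK'(2)[OF that] by auto
  have h01: "0 \<le> H x powr (1 / p) \<and> H x powr (1 / p) \<le> 1" if "x \<in> space M" for x
    using H01[OF that] p by (auto intro: powr_le1)
  have gKm: "(\<lambda>x. \<integral>y. g y \<partial>K x) \<in> borel_measurable M"
    by (rule measurable_compose[OF measurable_prob_algebraD[OF K] integral_measurable_subprob_algebra[OF g]])
  have g01: "0 \<le> (\<integral>y. g y \<partial>K x) \<and> (\<integral>y. g y \<partial>K x) \<le> 1" if "x \<in> space M" for x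
    using prob_integral_unit(2,3)[OF sK(3)[OF that] gK(1)[OF that g]] b sK(2)[OF that] by auto
  have mP: "f \<in> borel_measurable P" "f \<in> borel_measurable Q" if "f \<in> borel_measurable M" for f :: "'a \<Rightarrow> real"
    using that measurable_cong_sets[OF sP(1) refl] measurable_cong_sets[OF sQ(1) refl] by auto
  have hm: "(\<lambda>x. H x powr (1 / p)) \<in> borel_measurable M" by simp
  have "(\<integral>y. g y \<partial>(P \<bind> K)) = (\<integral>x. (\<integral>y. g y \<partial>K x) \<partial>P)"
    by (rule integral_bind_prob_algebra[OF P K g b])
  also have "\<dots> \<le> (\<integral>x. B2 * H x powr (1 / p) \<partial>P)"
  proof (rule integral_mono)
    show "integrable P (\<lambda>x. \<integral>y. g y \<partial>K x)"
      using prob_integral_unit(1)[OF sP(3) mP(1)[OF gKm]] g01 sP(2) by auto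
    show "integrable P (\<lambda>x. B2 * H x powr (1 / p))"
      using prob_integral_unit(1)[OF sP(3) mP(1)[OF hm]] h01 sP(2) by auto
    show "(\<integral>y. g y \<partial>K x) \<le> B2 * H x powr (1 / p)" if "x \<in> space P" for x
      using KK'[of x] gK(2)[OF _ g] b that sK'(2) sP(2) unfolding holder_dominated_def H_def p(2) p_def
      by auto
  qed
  also have "\<dots> = B2 * (\<integral>x. H x powr (1 / p) \<partial>P)" by simp
  also have "(\<integral>x. H x powr (1 / p) \<partial>P) \<le> B1 * (\<integral>x. (H x powr (1 / p)) powr p \<partial>Q) powr (1 / p)"
    using PQ mP(2)[OF hm] h01 unfolding holder_dominated_def p(2) p_def[symmetric] by (auto simp: sQ(2))
  also have "(\<integral>x. (H x powr (1 / p)) powr p \<partial>Q) = (\<integral>x. H x \<partial>Q)"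
    using p H01 sQ(2) by (intro Bochner_Integration.integral_cong) (auto simp: powr_powr)
  also have "(\<integral>x. H x \<partial>Q) = (\<integral>y. g y powr p \<partial>(Q \<bind> K'))"
    unfolding H_def by (rule integral_bind_prob_algebra[OF Q K' gp bp, symmetric])
  finally have "(\<integral>y. g y \<partial>(P \<bind> K))
      \<le> B2 * (B1 * (\<integral>y. g y powr p \<partial>(Q \<bind> K')) powr (1 / p))"
    using B2 by (simp add: mult_left_mono)
  then show "(\<integral>y. g y \<partial>(P \<bind> K))
      \<le> B1 * B2 * (\<integral>y. g y powr ((l + 1) / l) \<partial>(Q \<bind> K')) powr (l / (l + 1))"
    unfolding p(2) p_def[symmetric] by (simp add: mult_ac)
qed

text \<open>Testing with the indicator of \<open>S\<close> gives
  \<open>P(S) \<le> B * Q(S) powr (l / (l + 1))\<close>, a weighted geometric mean of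
  \<open>exp \<epsilon> * Q(S)\<close> and \<open>\<delta>\<close> by the bound on
  \<open>B\<close>.\<close>

lemma holder_dominated_imp_measure_le:
  assumes hd: "holder_dominated l B P Q" and "prob_space P" "prob_space Q" "sets P = sets Q"
    and S: "S \<in> sets Q" and l: "l > 0" and B: "0 \<le> B" "B powr (l + 1) \<le> exp (l * \<epsilon>) * \<delta>" and \<delta>: "\<delta> \<ge> 0"
  shows "measure P S \<le> exp \<epsilon> * measure Q S + \<delta>"
proof -
  interpret P: prob_space P by fact
  interpret Q: prob_space Q by fact
  define y where "y = measure Q S"
  have y: "y \<ge> 0" by (simp add: y_def)
  have "(\<integral>x. indicator S x \<partial>P) \<le> B * (\<integral>x. (indicator S x :: real) powr ((l + 1) / l) \<partial>Q) powr (l / (l + 1))"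
    by (rule hd[unfolded holder_dominated_def, rule_format]) (use S in \<open>auto split: split_indicator\<close>)
  moreover have "(\<lambda>x. (indicator S x :: real) powr ((l + 1) / l)) = indicator S"
    by (auto split: split_indicator)
  ultimately have 1: "measure P S \<le> B * y powr (l / (l + 1))"
    using S assms(4) sets.sets_into_space[OF S] sets_eq_imp_space_eq[OF assms(4)] by (simp add: y_def Int_absorb2)
  \<comment> \<open>A geometric mean is at most the maximum, and the maximum of nonnegative numbers
    is at most their sum.\<close>
  define m where "m = max (exp \<epsilon> * y) \<delta>"
  have m: "m \<ge> 0" using \<delta> by (simp add: m_def le_max_iff_disj)
  have "(B * y powr (l / (l + 1))) powr (l + 1) = B powr (l + 1) * y powr l"
    using B y l by (simp add: powr_mult powr_powr)
  also have "\<dots> \<le> exp (l * \<epsilon>) * \<delta> * y powr l"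
    using B by (intro mult_right_mono) auto
  also have "\<dots> = (exp \<epsilon> * y) powr l * \<delta>"
    using y by (simp add: powr_mult exp_powr_real mult_ac)
  also have "\<dots> \<le> m powr l * m"
    using y l \<delta> by (intro mult_mono powr_mono2) (auto simp: m_def)
  also have "\<dots> = m powr (l + 1)" using m l by (simp add: powr_add)
  finally have "B * y powr (l / (l + 1)) \<le> m"
    using powr_less_mono2[of "l + 1" m "B * y powr (l / (l + 1))"] l m by force
  also have "\<dots> \<le> exp \<epsilon> * y + \<delta>" using y \<delta> by (auto simp: m_def)
  finally show ?thesis using 1 by (simp add: y_def)
qed

section \<open>The multivariate Gaussian\<close>

lemma Basis_vec_real: "(Basis :: (real^'m) set) = range (\<lambda>j. axis j 1)"
  by (auto simp: Basis_vec_def)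

lemma prod_Basis_vec:
  "(\<Prod>b\<in>(Basis :: (real^'m) set). F b) = (\<Prod>j\<in>UNIV. F (axis j 1))"
  unfolding Basis_vec_real
  by (subst prod.reindex) (auto simp: inj_on_def axis_eq_axis)

lemma nn_integral_lborel_prod_vec:
  fixes f :: "'m::finite \<Rightarrow> real \<Rightarrow> ennreal"
  assumes f[measurable]: "\<And>j. f j \<in> borel_measurable borel"
  shows "(\<integral>\<^sup>+x. (\<Prod>j\<in>UNIV. f j (x $ j)) \<partial>(lborel :: (real^'m) measure)) = (\<Prod>j\<in>UNIV. (\<integral>\<^sup>+t. f j t \<partial>lborel))"
proof -
  \<comment> \<open>The product formula is indexed by basis vectors; \<open>THE\<close> recovers the
    coordinate index from the vector, which is unambiguous since \<open>axis\<close> is injective in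
    it.\<close>
  define F where "F = (\<lambda>b::real^'m. f (THE j. b = axis j 1))"
  have F: "F (axis j 1) = f j" for j
    unfolding F_def by (rule arg_cong[where f = f]) (auto simp: axis_eq_axis)
  have "(\<integral>\<^sup>+x. (\<Prod>b\<in>Basis. F b (x \<bullet> b)) \<partial>lborel) = (\<Prod>b\<in>Basis. (\<integral>\<^sup>+t. F b t \<partial>lborel))"
    by (rule nn_integral_lborel_prod) (auto simp: F_def)
  then show ?thesis unfolding prod_Basis_vec F by (simp add: inner_axis)
qed

lemma sets_gaussian [simp, measurable_cong]: "sets (gaussian \<tau> :: (real^'m) measure) = sets borel"
  by (simp add: gaussian_def)

lemma space_gaussian [simp]: "space (gaussian \<tau> :: (real^'m) measure) = UNIV"
  by (simp add: gaussian_def)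

text \<open>Boxes determine the measure, so this product formula yields total mass, marginals and
  independence of the coordinates.\<close>

lemma emeasure_gaussian_box:
  assumes [measurable]: "\<And>j. A j \<in> sets borel"
  shows "emeasure (gaussian \<tau> :: (real^'m) measure) {x. \<forall>j. x $ j \<in> A j}
    = (\<Prod>j\<in>UNIV. emeasure (density lborel (normal_density 0 \<tau>)) (A j))"
proof -
  have [measurable]: "{x :: real^'m. \<forall>j. x $ j \<in> A j} \<in> sets borel" by measurable
  have "emeasure (gaussian \<tau> :: (real^'m) measure) {x. \<forall>j. x $ j \<in> A j}
    = (\<integral>\<^sup>+x. ennreal (\<Prod>j\<in>UNIV. normal_density 0 \<tau> (x $ j)) * indicator {x. \<forall>j. x $ j \<in> A j} x \<partial>(lborel :: (real^'m) measure))"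
    unfolding gaussian_def by (subst emeasure_density) auto
  also have "\<dots> = (\<integral>\<^sup>+x. (\<Prod>j\<in>UNIV. ennreal (normal_density 0 \<tau> (x $ j)) * indicator (A j) (x $ j)) \<partial>(lborel :: (real^'m) measure))"
  proof (intro nn_integral_cong)
    fix x :: "real^'m"
    have "(\<Prod>j\<in>UNIV. indicator (A j) (x $ j)) = (indicator {x. \<forall>j. x $ j \<in> A j} x :: ennreal)"
      by (auto simp: indicator_def prod_zero_iff)
    then show "ennreal (\<Prod>j\<in>UNIV. normal_density 0 \<tau> (x $ j)) * indicator {x. \<forall>j. x $ j \<in> A j} x
      = (\<Prod>j\<in>UNIV. ennreal (normal_density 0 \<tau> (x $ j)) * indicator (A j) (x $ j))"
      by (simp add: prod.distrib prod_ennreal)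
  qed
  also have "\<dots> = (\<Prod>j\<in>UNIV. \<integral>\<^sup>+t. ennreal (normal_density 0 \<tau> t) * indicator (A j) t \<partial>lborel)"
    by (rule nn_integral_lborel_prod_vec) measurable
  also have "\<dots> = (\<Prod>j\<in>UNIV. emeasure (density lborel (normal_density 0 \<tau>)) (A j))"
    by (intro prod.cong refl) (subst emeasure_density, auto)
  finally show ?thesis .
qed

text \<open>The logarithm of the density of \<open>N(v, \<tau>\<^sup>2 I)\<close> relative to \<open>N(0, \<tau>\<^sup>2 I)\<close>.\<close>

definition log_ratio :: "real \<Rightarrow> real^'m \<Rightarrow> real^'m \<Rightarrow> real" where
  "log_ratio \<tau> v x = (v \<bullet> x) / \<tau>\<^sup>2 - (norm v / \<tau>)\<^sup>2 / 2"

lemma borel_measurable_log_ratio [measurable]: "log_ratio \<tau> v \<in> borel_measurable borel"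
  unfolding log_ratio_def by measurable

context
  fixes \<tau> :: real
  assumes \<tau>: "\<tau> > 0"
begin

lemma prob_space_gaussian: "prob_space (gaussian \<tau> :: (real^'m) measure)"
proof
  interpret N: prob_space "density lborel (normal_density 0 \<tau>)" by (rule prob_space_normal_density[OF \<tau>])
  have "emeasure (density lborel (normal_density 0 \<tau>)) UNIV = 1" using N.emeasure_space_1 by simp
  then show "emeasure (gaussian \<tau> :: (real^'m) measure) (space (gaussian \<tau>)) = 1"
    using emeasure_gaussian_box[of "\<lambda>_::'m. UNIV" \<tau>] by simp
qed

lemma distr_gaussian_component:
  "distr (gaussian \<tau> :: (real^'m) measure) borel (\<lambda>x. x $ j) = density lborel (normal_density 0 \<tau>)"
proof (rule measure_eqI)
  fix A :: "real set" assume "A \<in> sets (distr (gaussian \<tau> :: (real^'m) measure) borel (\<lambda>x. x $ j))"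
  then have A[measurable]: "A \<in> sets borel" by simp
  interpret N: prob_space "density lborel (normal_density 0 \<tau>)" by (rule prob_space_normal_density[OF \<tau>])
  have one: "emeasure (density lborel (normal_density 0 \<tau>)) UNIV = 1" using N.emeasure_space_1 by simp
  have "{x :: real^'m. x $ j \<in> A} = {x. \<forall>i. x $ i \<in> (if i = j then A else UNIV)}" by auto
  then have "emeasure (gaussian \<tau>) {x :: real^'m. x $ j \<in> A}
      = (\<Prod>i\<in>UNIV. emeasure (density lborel (normal_density 0 \<tau>)) (if i = j then A else UNIV))"
    by (simp only:) (subst emeasure_gaussian_box, auto)
  also have "\<dots> = (\<Prod>i\<in>UNIV. if i = j then emeasure (density lborel (normal_density 0 \<tau>)) A else 1)"
    by (intro prod.cong) (auto simp: one)
  finally show "emeasure (distr (gaussian \<tau> :: (real^'m) measure) borel (\<lambda>x. x $ j)) A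
      = emeasure (density lborel (normal_density 0 \<tau>)) A"
    by (subst emeasure_distr) (auto simp: vimage_def prod.delta)
qed simp

lemma distributed_gaussian_component:
  "distributed (gaussian \<tau> :: (real^'m) measure) lborel (\<lambda>x. x $ j) (normal_density 0 \<tau>)"
  unfolding distributed_def
  using distr_gaussian_component[of j]
    distr_cong[OF refl sets_lborel refl, of "gaussian \<tau> :: (real^'m) measure" "\<lambda>x. x $ j"] by auto

lemma indep_vars_gaussian_components:
  "prob_space.indep_vars (gaussian \<tau> :: (real^'m) measure) (\<lambda>_. borel) (\<lambda>j x. x $ j) UNIV"
proof -
  interpret prob_space "gaussian \<tau> :: (real^'m) measure" by (rule prob_space_gaussian)
  interpret N: prob_space "density lborel (normal_density 0 \<tau>)" by (rule prob_space_normal_density[OF \<tau>])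
  interpret product_sigma_finite "\<lambda>_::'m. density lborel (normal_density 0 \<tau>)" ..
  have "distr (gaussian \<tau> :: (real^'m) measure) (\<Pi>\<^sub>M i\<in>UNIV. borel) (\<lambda>x. \<lambda>i\<in>UNIV. x $ i)
      = (\<Pi>\<^sub>M i\<in>UNIV. density lborel (normal_density 0 \<tau>))"
  proof (rule PiM_eqI)
    fix A :: "'m \<Rightarrow> real set" assume "\<And>i. i \<in> UNIV \<Longrightarrow> A i \<in> sets (density lborel (normal_density 0 \<tau>))"
    then have A[measurable]: "A i \<in> sets borel" for i by simp
    have "(\<lambda>x. \<lambda>i\<in>UNIV. x $ i) -` Pi\<^sub>E UNIV A \<inter> space (gaussian \<tau>) = {x :: real^'m. \<forall>j. x $ j \<in> A j}"
      by auto
    then show "emeasure (distr (gaussian \<tau> :: (real^'m) measure) (\<Pi>\<^sub>M i\<in>UNIV. borel) (\<lambda>x. \<lambda>i\<in>UNIV. x $ i)) (Pi\<^sub>E UNIV A)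
      = (\<Prod>i\<in>UNIV. emeasure (density lborel (normal_density 0 \<tau>)) (A i))"
      by (subst emeasure_distr) (auto intro!: sets_PiM_I_finite emeasure_gaussian_box)
  qed (auto intro!: sets_PiM_cong)
  then show ?thesis
    by (subst indep_vars_iff_distr_eq_PiM) (auto simp: distr_gaussian_component)
qed

lemma distributed_gaussian_inner:
  fixes v :: "real^'m"
  assumes v: "v \<noteq> 0"
  shows "distributed (gaussian \<tau>) lborel (\<lambda>x. v \<bullet> x) (normal_density 0 (norm v * \<tau>))"
proof -
  interpret prob_space "gaussian \<tau> :: (real^'m) measure" by (rule prob_space_gaussian)
  \<comment> \<open>Coordinates where \<open>v\<close> vanishes would contribute normals of standard
    deviation 0, which have no density; they are dropped from the sum.\<close>
  define I where "I = {j. v $ j \<noteq> 0}"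
  have I: "I \<noteq> {}" using v by (auto simp: I_def vec_eq_iff)
  have "distributed (gaussian \<tau>) lborel (\<lambda>x. \<Sum>i\<in>I. v $ i * x $ i)
      (normal_density (\<Sum>i\<in>I. 0) (sqrt (\<Sum>i\<in>I. (\<bar>v $ i\<bar> * \<tau>)\<^sup>2)))"
  proof (rule sum_indep_normal)
    have "indep_vars (\<lambda>_. borel) (\<lambda>j x. x $ j) I"
      by (rule indep_vars_subset[OF indep_vars_gaussian_components]) auto
    then show "indep_vars (\<lambda>_. borel) (\<lambda>i x. v $ i * x $ i) I"
      using indep_vars_compose2[of "\<lambda>_. borel" "\<lambda>j x. x $ j" I "\<lambda>i t. v $ i * t" "\<lambda>_. borel"] by simp
    fix i assume "i \<in> I"
    then have "v $ i \<noteq> 0" by (simp add: I_def)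
    then show "distributed (gaussian \<tau>) lborel (\<lambda>x. v $ i * x $ i) (normal_density 0 (\<bar>v $ i\<bar> * \<tau>))"
      and "0 < \<bar>v $ i\<bar> * \<tau>"
      using normal_density_affine[OF distributed_gaussian_component[of i] \<tau>, of "v $ i" 0] \<tau> by auto
  qed (use I in auto)
  moreover have "(\<Sum>i\<in>I. v $ i * x $ i) = v \<bullet> x" for x
    unfolding inner_vec_def I_def inner_real_def by (rule sum.mono_neutral_left) auto
  moreover have "sqrt (\<Sum>i\<in>I. (\<bar>v $ i\<bar> * \<tau>)\<^sup>2) = norm v * \<tau>"
  proof -
    have "(\<Sum>i\<in>I. (\<bar>v $ i\<bar> * \<tau>)\<^sup>2) = (\<Sum>i\<in>UNIV. (v $ i)\<^sup>2) * \<tau>\<^sup>2"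
      unfolding sum_distrib_right power_mult_distrib power2_abs
      by (rule sum.mono_neutral_left) (auto simp: I_def)
    then show ?thesis using \<tau> by (simp add: norm_vec_def L2_set_def real_sqrt_mult)
  qed
  ultimately show ?thesis by simp
qed

text \<open>An affine image of \<open>v \<bullet> x\<close> with slope \<open>1 / \<tau>^2\<close>,
  so the standard deviation \<open>norm v * \<tau>\<close> becomes
  \<open>norm v / \<tau>\<close>.\<close>

lemma distributed_log_ratio:
  fixes v :: "real^'m"
  assumes v: "v \<noteq> 0"
  shows "distributed (gaussian \<tau>) lborel (log_ratio \<tau> v)
    (normal_density (- (norm v / \<tau>)\<^sup>2 / 2) (norm v / \<tau>))"
proof -
  interpret prob_space "gaussian \<tau> :: (real^'m) measure" by (rule prob_space_gaussian)
  have "distributed (gaussian \<tau>) lborel (\<lambda>x. - (norm v / \<tau>)\<^sup>2 / 2 + 1 / \<tau>\<^sup>2 * (v \<bullet> x))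
      (normal_density (- (norm v / \<tau>)\<^sup>2 / 2 + 1 / \<tau>\<^sup>2 * 0) (\<bar>1 / \<tau>\<^sup>2\<bar> * (norm v * \<tau>)))"
    by (rule normal_density_affine[OF distributed_gaussian_inner[OF v]]) (use v \<tau> in auto)
  moreover have "\<bar>1 / \<tau>\<^sup>2\<bar> * (norm v * \<tau>) = norm v / \<tau>"
    using \<tau> by (simp add: power2_eq_square field_simps)
  moreover have "(\<lambda>x. - (norm v / \<tau>)\<^sup>2 / 2 + 1 / \<tau>\<^sup>2 * (v \<bullet> x)) = log_ratio \<tau> v"
    by (auto simp: log_ratio_def)
  ultimately show ?thesis by simp
qed

text \<open>Reduces integrals over the model space to one dimension: the shift \<open>v\<close>
  enters only through \<open>norm v / \<tau>\<close>.\<close>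

lemma has_bochner_integral_gaussian_log_ratio:
  fixes v :: "real^'m" and h :: "real \<Rightarrow> real"
  assumes "v \<noteq> 0" and h: "h \<in> borel_measurable borel"
    and "has_bochner_integral lborel
      (\<lambda>u. normal_density (- (norm v / \<tau>)\<^sup>2 / 2) (norm v / \<tau>) u * h u) c"
  shows "has_bochner_integral (gaussian \<tau>) (\<lambda>x. h (log_ratio \<tau> v x)) c"
  using distributed_integral[OF distributed_log_ratio[OF assms(1)], of h]
    distributed_integrable[OF distributed_log_ratio[OF assms(1)], of h] assms(2,3)
  by (auto simp: has_bochner_integral_iff)

lemma gaussian_density_shift:
  fixes v x :: "real^'m"
  shows "(\<Prod>j\<in>UNIV. normal_density 0 \<tau> ((x - v) $ j))
    = (\<Prod>j\<in>UNIV. normal_density 0 \<tau> (x $ j)) * exp (log_ratio \<tau> v x)"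
proof -
  have "normal_density 0 \<tau> ((x - v) $ j)
      = normal_density 0 \<tau> (x $ j) * exp (v $ j * x $ j / \<tau>\<^sup>2 - (v $ j)\<^sup>2 / \<tau>\<^sup>2 / 2)" for j
    using \<tau> unfolding normal_density_def
    by (simp add: field_simps power2_eq_square flip: exp_add)
  then have "(\<Prod>j\<in>UNIV. normal_density 0 \<tau> ((x - v) $ j))
      = (\<Prod>j\<in>UNIV. normal_density 0 \<tau> (x $ j)) * exp (\<Sum>j\<in>UNIV. v $ j * x $ j / \<tau>\<^sup>2 - (v $ j)\<^sup>2 / \<tau>\<^sup>2 / 2)"
    by (simp add: prod.distrib exp_sum)
  also have "(\<Sum>j\<in>UNIV. v $ j * x $ j / \<tau>\<^sup>2 - (v $ j)\<^sup>2 / \<tau>\<^sup>2 / 2) = log_ratio \<tau> v x"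
    unfolding log_ratio_def sum_subtractf
    by (simp add: inner_vec_def sum_divide_distrib power_divide norm_vec_def L2_set_def sum_nonneg)
  finally show ?thesis .
qed

text \<open>The Cameron-Martin formula, from translation invariance of Lebesgue measure and the
  density quotient computed before.\<close>

lemma integral_gaussian_shift:
  fixes v :: "real^'m" and g :: "real^'m \<Rightarrow> real"
  assumes g[measurable]: "g \<in> borel_measurable borel"
  shows "(\<integral>x. g (v + x) \<partial>gaussian \<tau>) = (\<integral>x. exp (log_ratio \<tau> v x) * g x \<partial>gaussian \<tau>)"
proof -
  let ?d = "\<lambda>x::real^'m. \<Prod>j\<in>UNIV. normal_density 0 \<tau> (x $ j)"
  have d0: "0 \<le> ?d x" for x by (intro prod_nonneg) simp
  have "(\<integral>x. g (v + x) \<partial>gaussian \<tau>) = (\<integral>x. ?d x * g (v + x) \<partial>lborel)"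
    unfolding gaussian_def using d0 by (subst integral_density) auto
  also have "\<dots> = (\<integral>x. ?d ((v + x) - v) * g (v + x) \<partial>lborel)" by simp
  also have "\<dots> = (\<integral>x. ?d (x - v) * g x \<partial>(distr lborel borel ((+) v)))"
    by (subst integral_distr) (auto simp: algebra_simps)
  also have "\<dots> = (\<integral>x. ?d (x - v) * g x \<partial>lborel)" by (simp add: lborel_distr_plus)
  also have "\<dots> = (\<integral>x. ?d x * (exp (log_ratio \<tau> v x) * g x) \<partial>lborel)"
    unfolding gaussian_density_shift by (simp add: mult_ac)
  also have "\<dots> = (\<integral>x. exp (log_ratio \<tau> v x) * g x \<partial>gaussian \<tau>)"
    unfolding gaussian_def using d0 by (subst integral_density) auto
  finally show ?thesis .
qed

end

section \<open>Moments of one round\<close>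

text \<open>Integrates the pointwise second-order bound on \<open>y powr m\<close>. The weighted
  chi-square integral of the remainder is of order \<open>1 / \<sigma>^2\<close>, which cancels one
  factor \<open>\<sigma>^2\<close> of \<open>m * (m - 1)\<close>.\<close>

lemma gaussian_mixture_moment:
  fixes v :: "real^'m" and q \<sigma> x \<gamma> m :: real
  assumes \<tau>: "\<tau> > 0" and x: "x < 0.165" and \<sigma>: "\<sigma> > 0" "\<sigma>\<^sup>2 \<ge> 34"
    and q: "0 \<le> q" "q < 1" "q * \<sigma> \<le> x"
    and v: "norm v * \<sigma> \<le> \<tau>" and \<gamma>: "\<gamma> \<ge> 2 + 16 * x" and m: "m = \<sigma>\<^sup>2 + 1 \<or> m = - \<sigma>\<^sup>2"
  defines "y \<equiv> \<lambda>n. 1 + q * (exp (log_ratio \<tau> v n) - 1)"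
  shows "integrable (gaussian \<tau>) (\<lambda>n. y n powr m)"
    and "(\<integral>n. y n powr m \<partial>gaussian \<tau>) \<le> 1 + (\<sigma>\<^sup>2 + 1) * \<gamma> / 2 * q\<^sup>2"
proof -
  interpret prob_space "gaussian \<tau> :: (real^'m) measure" by (rule prob_space_gaussian[OF \<tau>])
  have x0: "x \<ge> 0" using q \<sigma> by (meson mult_nonneg_nonneg less_imp_le order_trans)
  have "integrable (gaussian \<tau>) (\<lambda>n. y n powr m) \<and>
    (\<integral>n. y n powr m \<partial>gaussian \<tau>) \<le> 1 + (\<sigma>\<^sup>2 + 1) * \<gamma> / 2 * q\<^sup>2"
  \<comment> \<open>Without a shift the log ratio is constantly 0 and has no normal density, so this
    case is separate.\<close>
  proof (cases "v = 0")
    case True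
    then have "y = (\<lambda>_. 1)" by (simp add: y_def log_ratio_def)
    then show ?thesis using \<gamma> x0 prob_space by simp
  next
    case False
    define r where "r = norm v / \<tau>"
    define X where "X = (\<sigma> + 2 / \<sigma>) * q"
    define b where "b = X + 1 / 4"
    define \<rho> where "\<rho> = r / sqrt (1 - b)"
    define I where "I = \<rho> / r * exp ((\<rho>\<^sup>2 - r\<^sup>2) / 8) * (exp (\<rho>\<^sup>2) - 1)"
    have r: "r > 0" "r \<le> 1 / \<sigma>" using False \<tau> \<sigma> v by (auto simp: r_def field_simps)
    have b: "b < 1" and E: "exp (X / 2) * I \<le> \<gamma> / \<sigma>\<^sup>2"
      using chi_square_weight_bound[OF x \<sigma> q(1,3) r \<gamma>]
      unfolding X_def[symmetric] b_def[symmetric] \<rho>_def[symmetric] I_def[symmetric] by auto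
    have b0: "b \<ge> 0" using q \<sigma> by (simp add: b_def X_def)
    have \<sigma>1: "\<sigma> \<ge> 1" using \<sigma> power2_le_imp_le[of 1 \<sigma>] by simp
    \<comment> \<open>Clipping makes the shift \<open>r\<close> at most \<open>1 / \<sigma>\<close>.
      Hence the weight in \<open>\<sigma>^2 * u^2\<close> is at most one in
      \<open>u^2 / r^2\<close>, the natural scale of the normal law of \<open>u\<close>.\<close>
    have rs: "\<sigma>\<^sup>2 \<le> 1 / r\<^sup>2"
    proof -
      have "\<sigma> \<le> 1 / r" using r \<sigma> by (simp add: field_simps)
      then have "\<sigma>\<^sup>2 \<le> (1 / r)\<^sup>2" using \<sigma> by (intro power_mono) auto
      then show ?thesis by (simp add: power_divide)
    qed
    note transfer = has_bochner_integral_gaussian_log_ratio[OF \<tau> False, folded r_def]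
    have i1: "has_bochner_integral (gaussian \<tau>) (\<lambda>n. exp (log_ratio \<tau> v n)) 1"
      by (rule transfer[OF _ has_bochner_integral_normal_exp[OF r(1)]]) simp
    have i2: "has_bochner_integral (gaussian \<tau>)
        (\<lambda>n. (exp (log_ratio \<tau> v n) - 1)\<^sup>2 * exp (b * (log_ratio \<tau> v n)\<^sup>2 / (2 * r\<^sup>2))) I"
      unfolding I_def \<rho>_def
      by (rule transfer[OF _ has_bochner_integral_normal_chi_square[OF r(1) b]]) simp
    have i0: "has_bochner_integral (gaussian \<tau> :: (real^'m) measure) (\<lambda>n. 1 :: real) 1"
      using prob_space by (simp add: has_bochner_integral_iff)
    define c where "c = \<sigma>\<^sup>2 * (\<sigma>\<^sup>2 + 1) / 2 * q\<^sup>2 * exp (X / 2)"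
    have c: "c \<ge> 0" by (simp add: c_def)
    define Z where "Z = (\<lambda>n. 1 + m * q * (exp (log_ratio \<tau> v n) - 1)
      + c * ((exp (log_ratio \<tau> v n) - 1)\<^sup>2 * exp (b * (log_ratio \<tau> v n)\<^sup>2 / (2 * r\<^sup>2))))"
    \<comment> \<open>The first-order term vanishes because the density ratio has mean 1; this is
      why the bound is quadratic in \<open>q\<close>.\<close>
    have Z: "has_bochner_integral (gaussian \<tau>) Z (1 + m * q * (1 - 1) + c * I)"
      unfolding Z_def
      by (intro has_bochner_integral_add has_bochner_integral_mult_right has_bochner_integral_diff i0 i1 i2)
    have le: "y n powr m \<le> Z n" for n
    proof -
      let ?u = "log_ratio \<tau> v n"
      have "y n powr m \<le> 1 + m * q * (exp ?u - 1) + c * ((exp ?u - 1)\<^sup>2 * exp (b * (\<sigma>\<^sup>2 * ?u\<^sup>2) / 2))"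
        using mix_exp_powr_le[OF q(1,2) \<sigma>1 m, of ?u] by (simp add: y_def c_def X_def b_def)
      also have "b * (\<sigma>\<^sup>2 * ?u\<^sup>2) / 2 \<le> b * (1 / r\<^sup>2 * ?u\<^sup>2) / 2"
        using b0 rs by (intro divide_right_mono mult_left_mono mult_right_mono) auto
      also have "b * (1 / r\<^sup>2 * ?u\<^sup>2) / 2 = b * ?u\<^sup>2 / (2 * r\<^sup>2)" by simp
      finally show ?thesis
        using c by (simp add: Z_def mult_left_mono)
    qed
    have y[measurable]: "y \<in> borel_measurable borel" unfolding y_def by measurable
    have int: "integrable (gaussian \<tau>) (\<lambda>n. y n powr m)"
    proof (rule Bochner_Integration.integrable_bound)
      show "integrable (gaussian \<tau>) Z" using Z by (simp add: has_bochner_integral_iff)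
      show "AE n in gaussian \<tau>. norm (y n powr m) \<le> norm (Z n)"
        using le by (intro AE_I2) (simp add: order_trans[OF le abs_ge_self])
    qed simp
    have "(\<integral>n. y n powr m \<partial>gaussian \<tau>) \<le> (\<integral>n. Z n \<partial>gaussian \<tau>)"
      using int le Z by (intro integral_mono) (auto simp: has_bochner_integral_iff)
    also have "\<dots> = 1 + c * I" using Z by (simp add: has_bochner_integral_iff)
    also have "c * I = \<sigma>\<^sup>2 * (\<sigma>\<^sup>2 + 1) / 2 * q\<^sup>2 * (exp (X / 2) * I)" by (simp add: c_def)
    also have "\<dots> \<le> \<sigma>\<^sup>2 * (\<sigma>\<^sup>2 + 1) / 2 * q\<^sup>2 * (\<gamma> / \<sigma>\<^sup>2)" using E by (intro mult_left_mono) auto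
    also have "\<dots> = (\<sigma>\<^sup>2 + 1) * \<gamma> / 2 * q\<^sup>2" using \<sigma> by simp
    finally show ?thesis using int by simp
  qed
  then show "integrable (gaussian \<tau>) (\<lambda>n. y n powr m)"
    and "(\<integral>n. y n powr m \<partial>gaussian \<tau>) \<le> 1 + (\<sigma>\<^sup>2 + 1) * \<gamma> / 2 * q\<^sup>2" by auto
qed

section \<open>Noise around a fixed sum, with and without one extra sampled element\<close>

definition noisy :: "real \<Rightarrow> real^'m \<Rightarrow> (real^'m) measure" where
  "noisy \<tau> a = distr (gaussian \<tau>) borel (\<lambda>n. a + n)"

text \<open>One round on the larger data set, conditioned on the sample of the common elements:
  \<open>a\<close> is the sum over that sample, \<open>v\<close> the contribution of the extra
  element, and the coin decides its inclusion.\<close>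

definition noisy_mixture :: "real \<Rightarrow> real \<Rightarrow> real^'m \<Rightarrow> real^'m \<Rightarrow> (real^'m) measure" where
  "noisy_mixture \<tau> q v a = measure_pmf (bernoulli_pmf q) \<bind> (\<lambda>b. noisy \<tau> (if b then v + a else a))"

lemma measurable_noisy:
  assumes \<tau>: "\<tau> > 0"
  shows "(noisy \<tau> :: real^'m \<Rightarrow> _) \<in> borel \<rightarrow>\<^sub>M prob_algebra borel"
proof -
  have [measurable]: "(gaussian \<tau> :: (real^'m) measure) \<in> space (prob_algebra borel)"
    using prob_space_gaussian[OF \<tau>] by (simp add: space_prob_algebra)
  show ?thesis unfolding noisy_def[abs_def] by measurable
qed

lemma noisy_in_prob_algebra: "\<tau> > 0 \<Longrightarrow> noisy \<tau> a \<in> space (prob_algebra borel)"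
  using measurable_space[OF measurable_noisy] by simp

lemma sets_noisy [simp]: "sets (noisy \<tau> a) = sets borel"
  by (simp add: noisy_def)

lemma measurable_prob_pmf:
  assumes "\<And>x. K x \<in> space (prob_algebra N)"
  shows "K \<in> measure_pmf p \<rightarrow>\<^sub>M prob_algebra N"
  using assms by (auto simp: measurable_def)

lemma pmf_in_prob_algebra: "measure_pmf p \<in> space (prob_algebra (measure_pmf q))"
  using measure_pmf.prob_space_axioms[of p] by (simp add: space_prob_algebra)

lemma bind_pmf_in_prob_algebra:
  assumes "\<And>x. K x \<in> space (prob_algebra N)"
  shows "measure_pmf p \<bind> K \<in> space (prob_algebra N)"
  using measurable_space[OF measurable_bind_prob_space[OF measurable_const[OF pmf_in_prob_algebra]
      measurable_prob_pmf[OF assms]], of "()" "count_space UNIV"] by simp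

lemma noisy_mixture_in_prob_algebra:
  "\<tau> > 0 \<Longrightarrow> noisy_mixture \<tau> q v a \<in> space (prob_algebra borel)"
  unfolding noisy_mixture_def by (intro bind_pmf_in_prob_algebra noisy_in_prob_algebra)

lemma integral_noisy:
  fixes g :: "real^'m \<Rightarrow> real"
  assumes "g \<in> borel_measurable borel"
  shows "(\<integral>x. g x \<partial>noisy \<tau> a) = (\<integral>n. g (a + n) \<partial>gaussian \<tau>)"
  unfolding noisy_def using assms by (subst integral_distr) auto

text \<open>Identifies \<open>1 + q * (exp u - 1)\<close>, with \<open>u\<close> the log ratio, as
  the density of the mixture. Everything is pulled back to the centred Gaussian by translating by
  \<open>a\<close>.\<close>

lemma integral_noisy_mixture:
  fixes g :: "real^'m \<Rightarrow> real"
  assumes \<tau>: "\<tau> > 0" and q: "0 \<le> q" "q \<le> 1" and g[measurable]: "g \<in> borel_measurable borel"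
    and b: "\<And>x. 0 \<le> g x \<and> g x \<le> 1"
  shows "integrable (gaussian \<tau>) (\<lambda>n. g (a + n) * (1 + q * (exp (log_ratio \<tau> v n) - 1)))"
    and "(\<integral>x. g x \<partial>noisy_mixture \<tau> q v a)
      = (\<integral>n. g (a + n) * (1 + q * (exp (log_ratio \<tau> v n) - 1)) \<partial>gaussian \<tau>)"
proof -
  interpret prob_space "gaussian \<tau> :: (real^'m) measure" by (rule prob_space_gaussian[OF \<tau>])
  have exp_int: "integrable (gaussian \<tau>) (\<lambda>n. exp (log_ratio \<tau> v n))"
  proof (cases "v = 0")
    case True
    then show ?thesis by (simp add: log_ratio_def)
  next
    case False
    then have "norm v / \<tau> > 0" using \<tau> by simp
    from has_bochner_integral_gaussian_log_ratio[OF \<tau> False _ has_bochner_integral_normal_exp[OF this]]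
    show ?thesis by (simp add: has_bochner_integral_iff)
  qed
  have i1: "integrable (gaussian \<tau>) (\<lambda>n. exp (log_ratio \<tau> v n) * g (a + n))"
  proof (rule Bochner_Integration.integrable_bound[OF exp_int])
    show "AE n in gaussian \<tau>. norm (exp (log_ratio \<tau> v n) * g (a + n)) \<le> norm (exp (log_ratio \<tau> v n))"
      using b by (intro AE_I2) (auto simp: abs_mult intro!: mult_left_le)
  qed simp
  have i2: "integrable (gaussian \<tau>) (\<lambda>n. g (a + n))"
    using b by (intro integrable_const_bound[where B = 1]) (auto intro!: AE_I2)
  have eq: "(\<lambda>n. g (a + n) * (1 + q * (exp (log_ratio \<tau> v n) - 1)))
      = (\<lambda>n. q * (exp (log_ratio \<tau> v n) * g (a + n)) + (1 - q) * g (a + n))"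
    by (auto simp: algebra_simps)
  show "integrable (gaussian \<tau>) (\<lambda>n. g (a + n) * (1 + q * (exp (log_ratio \<tau> v n) - 1)))"
    unfolding eq using i1 i2 by auto
  have "(\<integral>x. g x \<partial>noisy_mixture \<tau> q v a)
      = (\<integral>c. (\<integral>x. g x \<partial>noisy \<tau> (if c then v + a else a)) \<partial>measure_pmf (bernoulli_pmf q))"
    unfolding noisy_mixture_def
    by (rule integral_bind_prob_algebra[OF pmf_in_prob_algebra measurable_prob_pmf, where N = borel])
      (auto simp: b noisy_in_prob_algebra[OF \<tau>])
  also have "\<dots> = q * (\<integral>n. g (v + a + n) \<partial>gaussian \<tau>) + (1 - q) * (\<integral>n. g (a + n) \<partial>gaussian \<tau>)"
    using q by (subst integral_measure_pmf_real[where A = UNIV]) (auto simp: UNIV_bool integral_noisy mult.commute)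
  also have "(\<integral>n. g (v + a + n) \<partial>gaussian \<tau>) = (\<integral>n. (\<lambda>z. g (a + z)) (v + n) \<partial>gaussian \<tau>)"
    by (simp add: ac_simps)
  also have "\<dots> = (\<integral>n. exp (log_ratio \<tau> v n) * g (a + n) \<partial>gaussian \<tau>)"
    by (rule integral_gaussian_shift[OF \<tau>]) simp
  finally show "(\<integral>x. g x \<partial>noisy_mixture \<tau> q v a)
      = (\<integral>n. g (a + n) * (1 + q * (exp (log_ratio \<tau> v n) - 1)) \<partial>gaussian \<tau>)"
    unfolding eq using i1 i2 by simp
qed

text \<open>Hoelder's inequality with exponents \<open>p = (l + 1) / l\<close> and
  \<open>l + 1\<close>, where \<open>l = \<sigma>^2\<close>. One direction calls for the moment of
  \<open>y\<close> of order \<open>l + 1\<close>, the other for the moment of order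
  \<open>- l\<close>; both have the same bound \<open>A\<close>.\<close>

lemma holder_dominated_noisy_mixture:
  fixes v a :: "real^'m" and q \<sigma> x \<gamma> :: real
  assumes \<tau>: "\<tau> > 0" and x: "x < 0.165" and \<sigma>: "\<sigma> > 0" "\<sigma>\<^sup>2 \<ge> 34"
    and q: "0 \<le> q" "q < 1" "q * \<sigma> \<le> x"
    and v: "norm v * \<sigma> \<le> \<tau>" and \<gamma>: "\<gamma> \<ge> 2 + 16 * x"
  defines "A \<equiv> 1 + (\<sigma>\<^sup>2 + 1) * \<gamma> / 2 * q\<^sup>2"
  shows "holder_dominated (\<sigma>\<^sup>2) (A powr (1 / (\<sigma>\<^sup>2 + 1))) (noisy_mixture \<tau> q v a) (noisy \<tau> a)"
    and "holder_dominated (\<sigma>\<^sup>2) (A powr (1 / (\<sigma>\<^sup>2 + 1))) (noisy \<tau> a) (noisy_mixture \<tau> q v a)"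
proof -
  interpret prob_space "gaussian \<tau> :: (real^'m) measure" by (rule prob_space_gaussian[OF \<tau>])
  define l where "l = \<sigma>\<^sup>2"
  have l: "l > 0" using \<sigma> by (simp add: l_def)
  define p where "p = (l + 1) / l"
  have p: "p > 1" "l / (l + 1) = 1 / p" using l by (auto simp: p_def field_simps)
  have pl: "1 / p + 1 / (l + 1) = 1" "l + 1 > 1" "1 / p * (l + 1) = l"
    using l unfolding p(2)[symmetric] by (auto simp: field_simps)
  define y where "y = (\<lambda>n. 1 + q * (exp (log_ratio \<tau> v n) - 1))"
  have ym[measurable]: "y \<in> borel_measurable borel" unfolding y_def by measurable
  have y: "y n > 0" for n unfolding y_def by (rule mix_exp_pos[OF q(1,2)])
  have yd: "1 + q * (exp (log_ratio \<tau> v n) - 1) = y n" for n by (simp add: y_def)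
  note mom = gaussian_mixture_moment[OF \<tau> x \<sigma> q v \<gamma>, unfolded yd, folded A_def l_def]
  note mix = integral_noisy_mixture[OF \<tau> q(1) less_imp_le[OF q(2)], where a = a and v = v, unfolded yd]
  have "1 / (l + 1) \<ge> 0" using l by simp
  note mono = powr_mono2[OF this]
  show "holder_dominated (\<sigma>\<^sup>2) (A powr (1 / (\<sigma>\<^sup>2 + 1))) (noisy_mixture \<tau> q v a) (noisy \<tau> a)"
    unfolding holder_dominated_def l_def[symmetric] p_def[symmetric] p(2)
  proof (intro ballI impI)
    fix g :: "real^'m \<Rightarrow> real"
    assume "g \<in> borel_measurable (noisy \<tau> a)" and b: "\<forall>x\<in>space (noisy \<tau> a). 0 \<le> g x \<and> g x \<le> 1"
    then have g[measurable]: "g \<in> borel_measurable borel"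
      using measurable_cong_sets[OF sets_noisy[of \<tau> a] refl, of "borel :: real measure"] by simp
    have b: "0 \<le> g x \<and> g x \<le> 1" for x using b by (simp add: noisy_def)
    have "(\<integral>x. g x \<partial>noisy_mixture \<tau> q v a) = (\<integral>n. g (a + n) * y n \<partial>gaussian \<tau>)"
      by (rule mix(2)[OF g b])
    also have "\<dots> \<le> (\<integral>n. g (a + n) powr p \<partial>gaussian \<tau>) powr (1 / p)
        * (\<integral>n. y n powr (l + 1) \<partial>gaussian \<tau>) powr (1 / (l + 1))"
    proof (rule integral_holder[OF _ _ _ _ p(1) pl(2,1)])
      show "integrable (gaussian \<tau>) (\<lambda>n. g (a + n) powr p)"
        using b p by (intro integrable_const_bound[where B = 1]) (auto intro!: AE_I2 powr_le1)
      show "integrable (gaussian \<tau>) (\<lambda>n. y n powr (l + 1))" by (rule mom(1)) simp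
    qed (use b y in \<open>auto intro: less_imp_le\<close>)
    also have "\<dots> \<le> (\<integral>n. g (a + n) powr p \<partial>gaussian \<tau>) powr (1 / p) * A powr (1 / (l + 1))"
      by (intro mult_left_mono mono mom(2)) auto
    finally show "(\<integral>x. g x \<partial>noisy_mixture \<tau> q v a)
        \<le> A powr (1 / (l + 1)) * (\<integral>x. g x powr p \<partial>noisy \<tau> a) powr (1 / p)"
      by (subst integral_noisy) (auto simp: mult.commute)
  qed
  show "holder_dominated (\<sigma>\<^sup>2) (A powr (1 / (\<sigma>\<^sup>2 + 1))) (noisy \<tau> a) (noisy_mixture \<tau> q v a)"
    unfolding holder_dominated_def l_def[symmetric] p_def[symmetric] p(2)
  proof (intro ballI impI)
    have sm: "sets (noisy_mixture \<tau> q v a) = sets borel"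
      using noisy_mixture_in_prob_algebra[OF \<tau>] by (auto simp: space_prob_algebra)
    then have spm: "space (noisy_mixture \<tau> q v a) = UNIV" by (auto dest: sets_eq_imp_space_eq)
    fix g :: "real^'m \<Rightarrow> real"
    assume "g \<in> borel_measurable (noisy_mixture \<tau> q v a)"
      and b: "\<forall>x\<in>space (noisy_mixture \<tau> q v a). 0 \<le> g x \<and> g x \<le> 1"
    then have g[measurable]: "g \<in> borel_measurable borel"
      using measurable_cong_sets[OF sm refl, of "borel :: real measure"] by simp
    have b: "0 \<le> g x \<and> g x \<le> 1" for x using b by (simp add: spm)
    have bp: "0 \<le> g x powr p \<and> g x powr p \<le> 1" for x using b p by (auto intro: powr_le1)
    have eq1: "(g (a + n) * y n powr (1 / p)) powr p = g (a + n) powr p * y n" for n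
      using b y[of n] p by (simp add: powr_mult powr_powr)
    have eq2: "(y n powr (- 1 / p)) powr (l + 1) = y n powr (- l)" for n
      using pl(3) by (simp add: powr_powr)
    \<comment> \<open>Inserting \<open>1 = y powr (1 / p) * y powr (- 1 / p)\<close> turns the first
      factor, raised to \<open>p\<close>, into an integral against the mixture, while the second,
      raised to \<open>l + 1\<close>, becomes \<open>y powr (- l)\<close>.\<close>
    have "(\<integral>x. g x \<partial>noisy \<tau> a) = (\<integral>n. (g (a + n) * y n powr (1 / p)) * y n powr (- 1 / p) \<partial>gaussian \<tau>)"
      using y by (subst integral_noisy) (auto simp: mult.assoc powr_minus less_imp_neq[THEN not_sym] field_simps)
    also have "\<dots> \<le> (\<integral>n. (g (a + n) * y n powr (1 / p)) powr p \<partial>gaussian \<tau>) powr (1 / p)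
        * (\<integral>n. (y n powr (- 1 / p)) powr (l + 1) \<partial>gaussian \<tau>) powr (1 / (l + 1))"
    proof (rule integral_holder[OF _ _ _ _ p(1) pl(2,1)])
      show "integrable (gaussian \<tau>) (\<lambda>n. (g (a + n) * y n powr (1 / p)) powr p)"
        unfolding eq1 by (rule mix(1)[OF _ bp]) simp
      show "integrable (gaussian \<tau>) (\<lambda>n. (y n powr (- 1 / p)) powr (l + 1))"
        unfolding eq2 by (rule mom(1)) simp
    qed (use b in auto)
    also have "\<dots> \<le> (\<integral>n. g (a + n) powr p * y n \<partial>gaussian \<tau>) powr (1 / p) * A powr (1 / (l + 1))"
      unfolding eq1 eq2 by (intro mult_left_mono mono mom(2)) auto
    also have "(\<integral>n. g (a + n) powr p * y n \<partial>gaussian \<tau>) = (\<integral>x. g x powr p \<partial>noisy_mixture \<tau> q v a)"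
      by (rule mix(2)[OF _ bp, symmetric]) simp
    finally show "(\<integral>x. g x \<partial>noisy \<tau> a)
        \<le> A powr (1 / (l + 1)) * (\<integral>x. g x powr p \<partial>noisy_mixture \<tau> q v a) powr (1 / p)"
      by (simp add: mult.commute)
  qed
qed

section \<open>The algorithm\<close>

lemma norm_clip_le:
  fixes v :: "'v::real_normed_vector"
  assumes "C > 0"
  shows "norm (clip C v) \<le> C"
proof (cases "norm v \<le> C")
  case True
  then have "max 1 (norm v / C) = 1" using assms by simp
  then show ?thesis using True by (simp add: clip_def)
next
  case False
  then have "max 1 (norm v / C) = norm v / C" using assms by simp
  then show ?thesis using False assms by (simp add: clip_def)
qed

lemma borel_measurable_clip [measurable]:
  "(clip C :: real^'m \<Rightarrow> _) \<in> borel_measurable borel"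
  unfolding clip_def[abs_def] by measurable

section \<open>Measurability of the gradient\<close>

text \<open>The derivative is represented by a unique vector, so the definite description in
  \<open>loss_grad\<close> denotes it. Its component along \<open>b\<close> is then a directional
  derivative, reached along the steps \<open>1 / Suc n\<close>.\<close>

lemma loss_grad_inner_LIMSEQ:
  fixes f :: "real^'m \<Rightarrow> 'x \<Rightarrow> real"
  assumes "(\<lambda>v. f v \<xi>) differentiable (at w)"
  shows "(\<lambda>n. (f (w + (1 / real (Suc n)) *\<^sub>R b) \<xi> - f w \<xi>) * real (Suc n)) \<longlonglongrightarrow> loss_grad f w \<xi> \<bullet> b"
proof -
  obtain D where D: "((\<lambda>v. f v \<xi>) has_derivative D) (at w)"
    using assms by (auto simp: differentiable_def)
  then have lin: "linear D" by (rule has_derivative_linear)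
  define g where "g = (\<Sum>b\<in>Basis. D b *\<^sub>R b)"
  have "D h = g \<bullet> h" for h
  proof -
    have "D h = D (\<Sum>b\<in>Basis. (h \<bullet> b) *\<^sub>R b)" by (simp add: euclidean_representation)
    also have "\<dots> = (\<Sum>b\<in>Basis. (h \<bullet> b) * D b)" using lin by (simp add: linear_sum linear_scale)
    also have "\<dots> = g \<bullet> h"
      unfolding g_def inner_sum_left by (simp add: inner_commute[of h] mult.commute)
    finally show ?thesis .
  qed
  then have "D = (\<lambda>h. g \<bullet> h)" by auto
  with D have gd: "GDERIV (\<lambda>v. f v \<xi>) w :> g" by (simp add: gderiv_def inner_commute)
  have "loss_grad f w \<xi> = g"
    unfolding loss_grad_def
  proof (rule the_equality)
    show "GDERIV (\<lambda>v. f v \<xi>) w :> g" by (rule gd)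
    fix g' assume "GDERIV (\<lambda>v. f v \<xi>) w :> g'"
    then have "(\<lambda>h. h \<bullet> g') = (\<lambda>h. h \<bullet> g)"
      using gd unfolding gderiv_def by (rule has_derivative_unique)
    then have "h \<bullet> g' = h \<bullet> g" for h by metis
    then have "(g' - g) \<bullet> (g' - g) = 0" by (simp add: inner_diff_right)
    then show "g' = g" by simp
  qed
  then have Dg: "D b = loss_grad f w \<xi> \<bullet> b" using \<open>D = _\<close> by simp
  have "((\<lambda>t. w + t *\<^sub>R b) has_derivative (\<lambda>t. t *\<^sub>R b)) (at 0)"
    by (auto intro!: derivative_eq_intros)
  then have "((\<lambda>t. f (w + t *\<^sub>R b) \<xi>) has_derivative (\<lambda>t. D (t *\<^sub>R b))) (at 0)"
    using has_derivative_compose[of "\<lambda>t. w + t *\<^sub>R b" "\<lambda>t. t *\<^sub>R b" 0 UNIV "\<lambda>v. f v \<xi>" D] D by simp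
  moreover have "(\<lambda>t. D (t *\<^sub>R b)) = (*) (D b)" using lin by (auto simp: linear_scale)
  ultimately have "((\<lambda>t. f (w + t *\<^sub>R b) \<xi>) has_real_derivative D b) (at 0)"
    by (simp add: has_field_derivative_def)
  then have "((\<lambda>h. (f (w + h *\<^sub>R b) \<xi> - f w \<xi>) / h) \<longlongrightarrow> D b) (at 0)"
    by (simp add: DERIV_def)
  moreover have "filterlim (\<lambda>n. 1 / real (Suc n)) (at 0) sequentially"
    unfolding filterlim_at using LIMSEQ_inverse_real_of_nat
    by (auto simp: inverse_eq_divide)
  ultimately have "(\<lambda>n. (f (w + (1 / real (Suc n)) *\<^sub>R b) \<xi> - f w \<xi>) / (1 / real (Suc n))) \<longlonglongrightarrow> D b"
    by (rule filterlim_compose)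
  then show ?thesis unfolding Dg by simp
qed

lemma borel_measurable_loss_grad:
  fixes f :: "real^'m \<Rightarrow> 'x \<Rightarrow> real"
  assumes f: "\<And>w. (\<lambda>v. f v \<xi>) differentiable (at w)"
  shows "(\<lambda>w. loss_grad f w \<xi>) \<in> borel_measurable borel"
proof (subst borel_measurable_euclidean_space, rule ballI)
  fix b :: "real^'m"
  have "continuous_on UNIV (\<lambda>v. f v \<xi>)"
    using f differentiable_imp_continuous_within by (auto simp: continuous_on_eq_continuous_within)
  then have [measurable]: "(\<lambda>v. f v \<xi>) \<in> borel_measurable borel"
    by (rule borel_measurable_continuous_onI)
  show "(\<lambda>w. loss_grad f w \<xi> \<bullet> b) \<in> borel_measurable borel"
    by (rule borel_measurable_LIMSEQ_real, rule loss_grad_inner_LIMSEQ, rule f) measurable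
qed

section \<open>Sampling and one client round\<close>

text \<open>The independent coins are reordered so that the coin of the extra element comes last,
  after the sample of the common elements is fixed.\<close>

lemma random_subset_insert:
  assumes "finite d" "x \<notin> d"
  shows "random_subset q (insert x d) = bind_pmf (random_subset q d)
    (\<lambda>J. map_pmf (\<lambda>b. if b then insert x J else J) (bernoulli_pmf q))"
proof -
  have eq: "{\<xi>\<in>insert x d. (h(x := b)) \<xi>} = (if b then insert x {\<xi>\<in>d. h \<xi>} else {\<xi>\<in>d. h \<xi>})" for b h
    using assms by auto
  show ?thesis
    unfolding random_subset_def Pi_pmf_insert'[OF assms] map_pmf_def bind_assoc_pmf bind_return_pmf eq
    by (rule bind_commute_pmf)
qed

lemma client_round_eq:
  "client_round f C \<sigma> q d w = measure_pmf (random_subset q d) \<bind>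
     (\<lambda>J. noisy (C * \<sigma>) (\<Sum>\<xi>\<in>J. clip C (loss_grad f w \<xi>)))"
  by (simp add: client_round_def noisy_def)

lemma client_round_in_prob_algebra:
  assumes "C > 0" "\<sigma> > 0"
  shows "client_round f C \<sigma> q d w \<in> space (prob_algebra borel)"
  unfolding client_round_eq using assms by (intro bind_pmf_in_prob_algebra noisy_in_prob_algebra) simp

text \<open>Conditioning on the common sample \<open>J\<close> exposes the mixture. Writing the
  shift as a difference of sums makes its two branches the sums over \<open>insert x J\<close> and
  \<open>J\<close> for every set \<open>J\<close>.\<close>

lemma client_round_insert_eq:
  fixes f :: "real^'m \<Rightarrow> 'x \<Rightarrow> real"
  assumes d: "finite d" "x \<notin> d" and \<tau>: "C > 0" "\<sigma> > 0"
  defines "S \<equiv> \<lambda>w J. \<Sum>\<xi>\<in>J. clip C (loss_grad f w \<xi>)"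
  shows "client_round f C \<sigma> q (insert x d) w = measure_pmf (random_subset q d) \<bind>
    (\<lambda>J. noisy_mixture (C * \<sigma>) q (S w (insert x J) - S w J) (S w J))"
proof -
  let ?G = "\<lambda>J. noisy (C * \<sigma>) (S w J)"
  let ?h = "\<lambda>J b. if b then insert x J else J"
  have \<tau>': "C * \<sigma> > 0" using \<tau> by simp
  have G: "?G \<in> measure_pmf p \<rightarrow>\<^sub>M subprob_algebra borel" for p
    by (intro measurable_prob_algebraD measurable_prob_pmf noisy_in_prob_algebra[OF \<tau>'])
  have "client_round f C \<sigma> q (insert x d) w = measure_pmf (random_subset q (insert x d)) \<bind> ?G"
    by (simp add: client_round_eq S_def)
  also have "\<dots> = measure_pmf (random_subset q d) \<bind> (\<lambda>J. measure_pmf (map_pmf (?h J) (bernoulli_pmf q)) \<bind> ?G)"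
    unfolding random_subset_insert[OF d] measure_pmf_bind
  proof (rule bind_assoc[where N = "count_space UNIV"])
    show "(\<lambda>J. measure_pmf (map_pmf (?h J) (bernoulli_pmf q)))
        \<in> measure_pmf (random_subset q d) \<rightarrow>\<^sub>M subprob_algebra (count_space UNIV)"
      using measurable_measure_pmf[of "\<lambda>J. map_pmf (?h J) (bernoulli_pmf q)"] by simp
    show "?G \<in> count_space UNIV \<rightarrow>\<^sub>M subprob_algebra borel"
      using measurable_space[OF G] by (auto simp: measurable_def)
  qed
  also have "\<dots> = measure_pmf (random_subset q d) \<bind>
    (\<lambda>J. noisy_mixture (C * \<sigma>) q (S w (insert x J) - S w J) (S w J))"
  proof (rule bind_cong[OF refl])
    fix J
    have "measure_pmf (map_pmf (?h J) (bernoulli_pmf q)) \<bind> ?G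
        = measure_pmf (bernoulli_pmf q) \<bind> (\<lambda>b. ?G (?h J b))"
      unfolding map_pmf_rep_eq
      by (rule bind_distr) (use measurable_space[OF G] in \<open>auto simp: measurable_def\<close>)
    also have "\<dots> = noisy_mixture (C * \<sigma>) q (S w (insert x J) - S w J) (S w J)"
      unfolding noisy_mixture_def by (intro bind_cong refl) auto
    finally show "measure_pmf (map_pmf (?h J) (bernoulli_pmf q)) \<bind> ?G
        = noisy_mixture (C * \<sigma>) q (S w (insert x J) - S w J) (S w J)" .
  qed
  finally show ?thesis .
qed

text \<open>A finite data set has finitely many samples, so each probability is a finite sum of
  functions Borel in the model.\<close>

lemma measurable_client_round:
  fixes f :: "real^'m \<Rightarrow> 'x \<Rightarrow> real"
  assumes C: "C > 0" "\<sigma> > 0" and d: "finite d" and f: "\<forall>w \<xi>. (\<lambda>v. f v \<xi>) differentiable (at w)"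
  shows "client_round f C \<sigma> q d \<in> borel \<rightarrow>\<^sub>M prob_algebra borel"
proof (rule measurable_prob_algebraI)
  let ?S = "\<lambda>w J. \<Sum>\<xi>\<in>J. clip C (loss_grad f w \<xi>)"
  note prob = client_round_in_prob_algebra[OF C, of f q d]
  show "prob_space (client_round f C \<sigma> q d w)" for w using prob[of w] by (simp add: space_prob_algebra)
  show "client_round f C \<sigma> q d \<in> borel \<rightarrow>\<^sub>M subprob_algebra borel"
  proof (rule measurable_subprob_algebra)
    show "subprob_space (client_round f C \<sigma> q d w)" "sets (client_round f C \<sigma> q d w) = sets borel" for w
      using prob[of w] by (auto simp: space_prob_algebra prob_space_imp_subprob_space)
    fix A :: "(real^'m) set" assume A: "A \<in> sets borel"
    have \<tau>: "C * \<sigma> > 0" using C by simp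
    have fin: "finite (set_pmf (random_subset q d))"
    proof (rule finite_subset)
      show "set_pmf (random_subset q d) \<subseteq> Pow d" by (auto simp: random_subset_def)
    qed (use d in simp)
    have "emeasure (client_round f C \<sigma> q d w) A
        = (\<Sum>J\<in>set_pmf (random_subset q d). emeasure (noisy (C * \<sigma>) (?S w J)) A * pmf (random_subset q d) J)" for w
      unfolding client_round_eq
      by (subst emeasure_bind_prob_algebra[OF pmf_in_prob_algebra measurable_prob_pmf[OF noisy_in_prob_algebra[OF \<tau>]] A])
        (simp add: nn_integral_measure_pmf_finite[OF fin])
    moreover have "(\<lambda>w. emeasure (noisy (C * \<sigma>) (?S w J)) A) \<in> borel_measurable borel" for J
    proof (rule measurable_compose[OF _ measurable_emeasure_kernel[OF measurable_prob_algebraD[OF measurable_noisy[OF \<tau>]] A]])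
      show "(\<lambda>w. ?S w J) \<in> borel_measurable borel"
        by (intro borel_measurable_sum measurable_compose[OF borel_measurable_loss_grad[OF f[rule_format]] borel_measurable_clip])
    qed
    ultimately show "(\<lambda>w. emeasure (client_round f C \<sigma> q d w) A) \<in> borel_measurable borel"
      by simp
  qed
qed

text \<open>Both laws average over the same common sample, which costs the factor 1, and domination
  holds for each fixed sample. Clipping bounds the shift by \<open>C\<close>, which cancels against
  the noise level \<open>C * \<sigma>\<close>.\<close>

lemma holder_dominated_client_round:
  fixes f :: "real^'m \<Rightarrow> 'x \<Rightarrow> real"
  assumes adj: "adjacent N d d'" and C: "C > 0" and x: "x < 0.165" and \<sigma>: "\<sigma> > 0" "\<sigma>\<^sup>2 \<ge> 34"
    and q: "0 \<le> q" "q < 1" "q * \<sigma> \<le> x" and \<gamma>: "\<gamma> \<ge> 2 + 16 * x"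
  shows "holder_dominated (\<sigma>\<^sup>2) ((1 + (\<sigma>\<^sup>2 + 1) * \<gamma> / 2 * q\<^sup>2) powr (1 / (\<sigma>\<^sup>2 + 1)))
    (client_round f C \<sigma> q d w) (client_round f C \<sigma> q d' w)"
proof -
  let ?B = "(1 + (\<sigma>\<^sup>2 + 1) * \<gamma> / 2 * q\<^sup>2) powr (1 / (\<sigma>\<^sup>2 + 1))"
  let ?S = "\<lambda>J. \<Sum>\<xi>\<in>J. clip C (loss_grad f w \<xi>)"
  have \<tau>: "C * \<sigma> > 0" using C \<sigma> by simp
  have l: "\<sigma>\<^sup>2 > 0" using \<sigma> by simp
  have "norm (?S (insert z J) - ?S J) \<le> C" for z J
  \<comment> \<open>The bound is proved for arbitrary sets: over an infinite \<open>J\<close> both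
    sums are 0 by convention, and inserting a present element changes nothing.\<close>
  proof (cases "finite J \<and> z \<notin> J")
    case True
    then show ?thesis using norm_clip_le[OF C] by simp
  next
    case False
    then show ?thesis using C by (auto simp: insert_absorb)
  qed
  then have n: "norm (?S (insert z J) - ?S J) * \<sigma> \<le> C * \<sigma>" for z J
    using \<sigma> by (simp add: mult_right_mono)
  note dom = holder_dominated_noisy_mixture[OF \<tau> x \<sigma> q n \<gamma>]
  let ?M = "\<lambda>z J. noisy_mixture (C * \<sigma>) q (?S (insert z J) - ?S J) (?S J)"
  let ?G = "\<lambda>J. noisy (C * \<sigma>) (?S J)"
  have M: "?M z \<in> measure_pmf p \<rightarrow>\<^sub>M prob_algebra borel" and G: "?G \<in> measure_pmf p \<rightarrow>\<^sub>M prob_algebra borel" for z p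
    by (intro measurable_prob_pmf noisy_mixture_in_prob_algebra[OF \<tau>] noisy_in_prob_algebra[OF \<tau>])+
  note refl = holder_dominated_refl[OF measure_pmf.prob_space_axioms l]
  have "holder_dominated (\<sigma>\<^sup>2) (1 * ?B) (measure_pmf p \<bind> ?M z) (measure_pmf p \<bind> ?G)"
    and "holder_dominated (\<sigma>\<^sup>2) (1 * ?B) (measure_pmf p \<bind> ?G) (measure_pmf p \<bind> ?M z)" for p z
    by (rule holder_dominated_bind[OF pmf_in_prob_algebra[of p p] pmf_in_prob_algebra[of p p] M G refl _ l];
        rule dom powr_ge_zero)
      (rule holder_dominated_bind[OF pmf_in_prob_algebra[of p p] pmf_in_prob_algebra[of p p] G M refl _ l];
        rule dom powr_ge_zero)
  then have main: "holder_dominated (\<sigma>\<^sup>2) ?B (client_round f C \<sigma> q (insert z e) w) (client_round f C \<sigma> q e w)"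
    "holder_dominated (\<sigma>\<^sup>2) ?B (client_round f C \<sigma> q e w) (client_round f C \<sigma> q (insert z e) w)"
    if "finite e" "z \<notin> e" for z and e :: "'x set"
    unfolding client_round_insert_eq[OF that C \<sigma>(1)] by (simp_all add: client_round_eq)
  consider z where "finite d" "z \<notin> d" "d' = insert z d" | z where "finite d'" "z \<notin> d'" "d = insert z d'"
    using adj unfolding adjacent_def by auto
  then show ?thesis
  proof cases
    case 1
    then show ?thesis using main(2) by metis
  next
    case 2
    then show ?thesis using main(1) by metis
  qed
qed

section \<open>Composition over the rounds\<close>

text \<open>Joint measurability in \<open>\<omega>\<close> and \<open>U\<close> serves both the
  integration over the server's randomness and, by fixing \<open>\<omega>\<close>, the comparison of
  two runs.\<close>

lemma measurable_round_kernel: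
  fixes f :: "real^'m \<Rightarrow> 'x \<Rightarrow> real"
  assumes C: "C > 0" "\<sigma> > 0" and d: "finite d" and f: "\<forall>w \<xi>. (\<lambda>v. f v \<xi>) differentiable (at w)"
    and srv: "(\<lambda>(\<omega>, U). server \<omega> i U) \<in> borel_measurable (R \<Otimes>\<^sub>M outputs i)"
  shows "(\<lambda>(\<omega>, U). client_round f C \<sigma> q d (server \<omega> i U) \<bind> (\<lambda>u. return (outputs (Suc i)) (U(i := u))))
    \<in> R \<Otimes>\<^sub>M outputs i \<rightarrow>\<^sub>M prob_algebra (outputs (Suc i))"
  unfolding case_prod_beta
proof (rule measurable_bind_prob_space2)
  show "(\<lambda>z. client_round f C \<sigma> q d (server (fst z) i (snd z))) \<in> R \<Otimes>\<^sub>M outputs i \<rightarrow>\<^sub>M prob_algebra borel"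
    using measurable_compose[OF srv measurable_client_round[OF C d f]] by (simp add: case_prod_beta)
  have "(\<lambda>z. (snd (fst z))(i := snd z)) \<in> (R \<Otimes>\<^sub>M outputs i) \<Otimes>\<^sub>M borel \<rightarrow>\<^sub>M outputs (Suc i)"
    by (rule measurable_fun_upd[where J = "{..<i}"]) (auto simp: lessThan_Suc)
  from measurable_compose[OF this measurable_return_prob_space]
  show "(\<lambda>(z, u). return (outputs (Suc i)) ((snd z)(i := u))) \<in> (R \<Otimes>\<^sub>M outputs i) \<Otimes>\<^sub>M borel \<rightarrow>\<^sub>M prob_algebra (outputs (Suc i))"
    by (simp add: case_prod_beta')
qed

lemma measurable_dp_sgd_run:
  fixes f :: "real^'m \<Rightarrow> 'x \<Rightarrow> real"
  assumes C: "C > 0" "\<sigma> > 0" and d: "finite d" and f: "\<forall>w \<xi>. (\<lambda>v. f v \<xi>) differentiable (at w)"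
    and srv: "\<And>i. (\<lambda>(\<omega>, U). server \<omega> i U) \<in> borel_measurable (R \<Otimes>\<^sub>M outputs i)"
  shows "(\<lambda>\<omega>. dp_sgd_run N s f C \<sigma> (server \<omega>) d i) \<in> R \<rightarrow>\<^sub>M prob_algebra (outputs i)"
proof (induction i)
  case 0
  show ?case
    by (auto simp: space_prob_algebra space_PiM intro!: measurable_const prob_space_return)
next
  case (Suc i)
  show ?case
    unfolding dp_sgd_run.simps
    by (rule measurable_bind_prob_space2[OF Suc measurable_round_kernel[where server = server and i = i, OF C d f srv]])
qed

text \<open>Given \<open>\<omega>\<close> and the same past outputs, the server sends the same model
  on both data sets. Each round thus contributes its own factor uniformly in the past, which allows
  adaptive composition.\<close>

lemma holder_dominated_dp_sgd_run:
  fixes f :: "real^'m \<Rightarrow> 'x \<Rightarrow> real"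
  assumes adj: "adjacent N' d d'" and C: "C > 0" and f: "\<forall>w \<xi>. (\<lambda>v. f v \<xi>) differentiable (at w)"
    and srv: "\<And>i. (\<lambda>(\<omega>, U). server \<omega> i U) \<in> borel_measurable (R \<Otimes>\<^sub>M outputs i)" and \<omega>: "\<omega> \<in> space R"
    and x: "x < 0.165" and \<sigma>: "\<sigma> > 0" "\<sigma>\<^sup>2 \<ge> 34" and \<gamma>: "\<gamma> \<ge> 2 + 16 * x"
    and q: "\<And>i. i < n \<Longrightarrow> real (s i) / real N < 1 \<and> real (s i) / real N * \<sigma> \<le> x"
  shows "holder_dominated (\<sigma>\<^sup>2)
    (\<Prod>i<n. (1 + (\<sigma>\<^sup>2 + 1) * \<gamma> / 2 * (real (s i) / real N)\<^sup>2) powr (1 / (\<sigma>\<^sup>2 + 1)))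
    (dp_sgd_run N s f C \<sigma> (server \<omega>) d n) (dp_sgd_run N s f C \<sigma> (server \<omega>) d' n)"
  using q
proof (induction n)
  case 0
  have "prob_space (return (outputs 0) (\<lambda>_. undefined) :: (nat \<Rightarrow> real^'m) measure)"
    by (intro prob_space_return) (simp add: space_PiM)
  from holder_dominated_refl[OF this, of "\<sigma>\<^sup>2"] show ?case using \<sigma> by simp
next
  case (Suc n)
  have fin: "finite d" "finite d'" using adj by (auto simp: adjacent_def)
  have l: "\<sigma>\<^sup>2 > 0" using \<sigma> by simp
  let ?B = "\<lambda>i. (1 + (\<sigma>\<^sup>2 + 1) * \<gamma> / 2 * (real (s i) / real N)\<^sup>2) powr (1 / (\<sigma>\<^sup>2 + 1))"
  let ?K = "\<lambda>e U. client_round f C \<sigma> (real (s n) / real N) e (server \<omega> n U) \<bind> (\<lambda>u. return (outputs (Suc n)) (U(n := u)))"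
  have run: "dp_sgd_run N s f C \<sigma> (server \<omega>) e n \<in> space (prob_algebra (outputs n))" if "finite e" for e
    using measurable_space[OF measurable_dp_sgd_run[OF C \<sigma>(1) that f srv] \<omega>] .
  have K: "?K e \<in> outputs n \<rightarrow>\<^sub>M prob_algebra (outputs (Suc n))" if "finite e" for e
    using measurable_Pair2[OF measurable_round_kernel[where server = server and i = n, OF C \<sigma>(1) that f srv] \<omega>] by simp
  have "holder_dominated (\<sigma>\<^sup>2) (?B n) (?K d U) (?K d' U)" if U: "U \<in> space (outputs n)" for U
  proof -
    have upd: "(\<lambda>u. U(n := u)) \<in> borel \<rightarrow>\<^sub>M outputs (Suc n)"
      by (rule measurable_fun_upd[where J = "{..<n}"]) (use U in \<open>auto simp: lessThan_Suc\<close>)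
    have ret: "(\<lambda>u. return (outputs (Suc n)) (U(n := u))) \<in> borel \<rightarrow>\<^sub>M prob_algebra (outputs (Suc n))"
      by (rule measurable_compose[OF upd measurable_return_prob_space])
    have q: "real (s n) / real N < 1" "real (s n) / real N * \<sigma> \<le> x" "0 \<le> real (s n) / real N"
      using Suc.prems[of n] by auto
    have "holder_dominated (\<sigma>\<^sup>2) (?B n * 1) (?K d U) (?K d' U)"
    proof (rule holder_dominated_bind[OF client_round_in_prob_algebra[OF C \<sigma>(1)]
          client_round_in_prob_algebra[OF C \<sigma>(1)] ret ret holder_dominated_client_round[OF adj C x \<sigma> q(3,1,2) \<gamma>] _ l])
      fix u :: "real^'m"
      have "prob_space (return (outputs (Suc n)) (U(n := u)))"
        using measurable_space[OF ret, of u] by (simp add: space_prob_algebra)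
      then show "holder_dominated (\<sigma>\<^sup>2) 1 (return (outputs (Suc n)) (U(n := u))) (return (outputs (Suc n)) (U(n := u)))"
        using l by (rule holder_dominated_refl)
    qed simp
    then show ?thesis by simp
  qed
  from holder_dominated_bind[OF run[OF fin(1)] run[OF fin(2)] K[OF fin(1)] K[OF fin(2)] _ this l, of "\<Prod>i<n. ?B i"]
  show ?case using Suc by simp
qed

section \<open>Arithmetic of the parameters\<close>

lemma dp_sgd_parameters:
  fixes N T :: nat and s :: "nat \<Rightarrow> nat"
    and K k sbar smax \<theta> \<epsilon> \<delta> \<sigma> \<gamma> :: real
  assumes N: "N \<ge> 10000" and T: "T \<ge> 1"
    and s: "\<forall>i<T. 0 < s i \<and> s i \<le> N"
    and K: "K = (\<Sum>i<T. real (s i))" and k: "k = K / real N"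
    and sbar: "sbar = (1 / real T) * (\<Sum>i<T. real (s i))"
    and smax: "smax = real (Max (s ` {..<T}))" and \<theta>: "\<theta> = smax / sbar"
    and \<epsilon>: "\<epsilon> > 0" and \<delta>: "\<delta> > 0" and \<sigma>0: "\<sigma> > 0"
    and \<sigma>: "\<sigma> = sqrt (2 * (\<epsilon> + ln (1 / \<delta>)) / \<epsilon>)"
    and \<delta>N: "\<delta> \<le> 1 / real N" and \<epsilon>5: "\<epsilon> < 0.5"
    and adm: "gamma_admissible \<epsilon> k \<sigma> \<gamma>"
    and kk: "(2 / exp 1)\<^sup>2 * k\<^sup>2 \<ge> 1 / 2 + ln (1 / \<delta>)"
    and TT: "real T \<ge> \<gamma> * \<theta>\<^sup>2 / \<epsilon> * k\<^sup>2"
  defines "x \<equiv> \<epsilon> / (\<gamma> * k) * \<sigma>"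
  shows "x < 0.165" and "\<sigma>\<^sup>2 \<ge> 34" and "\<gamma> \<ge> 2 + 16 * x"
    and "\<And>i. i < T \<Longrightarrow> real (s i) / real N < 1 \<and> real (s i) / real N * \<sigma> \<le> x"
    and "(\<Sum>i<T. (\<sigma>\<^sup>2 + 1) * \<gamma> / 2 * (real (s i) / real N)\<^sup>2) \<le> \<sigma>\<^sup>2 * \<epsilon> + ln \<delta>"
proof -
  define \<Lambda> where "\<Lambda> = ln (1 / \<delta>)"
  define a where "a = \<epsilon> / (\<gamma> * k)"
  have N0: "real N > 0" and T0: "real T > 0" using N T by auto
  have "(\<Sum>i<T. real (s i)) > 0" using s T by (intro sum_pos) (auto simp: lessThan_empty_iff)
  then have K0: "K > 0" by (simp add: K)
  then have k0: "k > 0" using N0 by (simp add: k)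
  \<comment> \<open>The value 8 is what \<open>\<sigma>^2 \<ge> 34\<close> asks for: that inequality
    amounts to \<open>16 * \<epsilon> \<le> \<Lambda>\<close>, and
    \<open>\<epsilon> < 0.5\<close>.\<close>
  have \<Lambda>8: "\<Lambda> \<ge> 8"
  proof -
    have "exp (8::real) = exp 1 ^ 8" by (simp flip: exp_of_nat_mult)
    also have "\<dots> \<le> (272 / 100) ^ 8" using e_less_272 by (intro power_mono) auto
    also have "\<dots> \<le> 10000" by (simp add: power_divide)
    also have "\<dots> \<le> real N" using N by simp
    also have "\<dots> \<le> 1 / \<delta>" using \<delta>N \<delta> N0 by (simp add: field_simps)
    finally show ?thesis unfolding \<Lambda>_def using \<delta> by (simp add: ln_ge_iff)
  qed
  have s2: "\<sigma>\<^sup>2 = 2 * (\<epsilon> + \<Lambda>) / \<epsilon>"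
    unfolding \<sigma> \<Lambda>_def[symmetric] using \<epsilon> \<Lambda>8 by (subst real_sqrt_pow2) auto
  then have s2e: "\<sigma>\<^sup>2 * \<epsilon> = 2 * (\<epsilon> + \<Lambda>)" using \<epsilon> by simp
  have s34: "\<sigma>\<^sup>2 \<ge> 34"
  proof -
    have "34 * \<epsilon> \<le> 2 * (\<epsilon> + \<Lambda>)" using \<epsilon>5 \<Lambda>8 by simp
    then show ?thesis unfolding s2 using \<epsilon> by (simp add: field_simps)
  qed
  from adm have \<gamma>0: "\<gamma> > 0" and a1: "a < 1" and den: "\<sigma> * (1 - a) - 2 * exp 1 * sqrt a > 0"
    and \<gamma>ge: "\<gamma> \<ge> 2 / (1 - a) + 2 ^ 4 * a / (1 - a) * (\<sigma> / (1 - sqrt a)\<^sup>2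
               + 1 / (\<sigma> * (1 - a) - 2 * exp 1 * sqrt a) * (exp 3 / \<sigma>)) * exp (3 / \<sigma>\<^sup>2)"
    unfolding gamma_admissible_def Let_def a_def by auto
  have a0: "a > 0" unfolding a_def using \<epsilon> \<gamma>0 k0 by simp
  have x_a: "x = a * \<sigma>" by (simp add: x_def a_def)
  have x0: "x > 0" using a0 \<sigma>0 by (simp add: x_a)
  \<comment> \<open>In the admissibility condition every factor dropped is at least 1 and the
    dropped summand is nonnegative; \<open>2 + 16 * a * \<sigma>\<close> is left.\<close>
  have \<gamma>x: "\<gamma> \<ge> 2 + 16 * x"
  proof -
    have sa: "0 < sqrt a" "sqrt a < 1" using a0 a1 by auto
    then have "(1 - sqrt a)\<^sup>2 \<le> 1" "(1 - sqrt a)\<^sup>2 > 0" by (auto simp: power_le_one)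
    then have "\<sigma> / 1 \<le> \<sigma> / (1 - sqrt a)\<^sup>2" using \<sigma>0 by (intro divide_left_mono) auto
    moreover have "0 \<le> 1 / (\<sigma> * (1 - a) - 2 * exp 1 * sqrt a) * (exp 3 / \<sigma>)" using den \<sigma>0 by simp
    ultimately have b: "\<sigma> \<le> \<sigma> / (1 - sqrt a)\<^sup>2
        + 1 / (\<sigma> * (1 - a) - 2 * exp 1 * sqrt a) * (exp 3 / \<sigma>)" by simp
    have c: "16 * a \<le> 2 ^ 4 * a / (1 - a)" using a0 a1 by (simp add: field_simps)
    have "16 * a * \<sigma> * 1 \<le> 2 ^ 4 * a / (1 - a) * (\<sigma> / (1 - sqrt a)\<^sup>2
        + 1 / (\<sigma> * (1 - a) - 2 * exp 1 * sqrt a) * (exp 3 / \<sigma>)) * exp (3 / \<sigma>\<^sup>2)"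
    proof (rule mult_mono[OF mult_mono[OF c b]])
      have "0 \<le> 16 * a" using a0 by simp
      then show "0 \<le> 2 ^ 4 * a / (1 - a)" using c by linarith
      show "0 \<le> 2 ^ 4 * a / (1 - a) * (\<sigma> / (1 - sqrt a)\<^sup>2
        + 1 / (\<sigma> * (1 - a) - 2 * exp 1 * sqrt a) * (exp 3 / \<sigma>))"
        by (rule mult_nonneg_nonneg) (use c b a0 \<sigma>0 in linarith)+
    qed (use \<sigma>0 in auto)
    moreover have "2 \<le> 2 / (1 - a)" using a0 a1 by (simp add: field_simps)
    ultimately show ?thesis using \<gamma>ge unfolding x_a by linarith
  qed
  \<comment> \<open>Squaring \<open>\<gamma> * x * k = \<epsilon> * \<sigma>\<close> and using the
    lower bound on \<open>k^2\<close> gives \<open>\<gamma> * x \<le> 2 / exp 1 < 0.741\<close>.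
    With \<open>\<gamma> \<ge> 2 + 16 * x\<close>, a value \<open>x \<ge> 0.165\<close> would force
    \<open>\<gamma> * x \<ge> 0.765\<close>.\<close>
  have x165: "x < 0.165"
  proof -
    have "\<gamma> * x * k = \<epsilon> * \<sigma>" using \<gamma>0 k0 by (simp add: x_a a_def)
    then have "(\<gamma> * x)\<^sup>2 * k\<^sup>2 = \<epsilon> * (\<sigma>\<^sup>2 * \<epsilon>)" by (metis power2_eq_square power_mult_distrib mult.assoc mult.commute)
    also have "\<dots> = 2 * \<epsilon> * (\<epsilon> + \<Lambda>)" unfolding s2e by simp
    also have "\<dots> \<le> 1 * (1 / 2 + \<Lambda>)" using \<epsilon> \<epsilon>5 \<Lambda>8 by (intro mult_mono) auto
    also have "\<dots> \<le> (2 / exp 1)\<^sup>2 * k\<^sup>2" using kk by (simp add: \<Lambda>_def)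
    finally have "(\<gamma> * x)\<^sup>2 \<le> (2 / exp 1)\<^sup>2" using k0 by simp
    then have "\<gamma> * x \<le> 2 / exp 1" by (rule power2_le_imp_le) simp
    also have "\<dots> \<le> 2 / 2.7"
    proof -
      have "(2.7 :: real) \<le> exp 1" using e_approx_32 by (simp add: abs_if split: if_splits)
      then show ?thesis by (intro divide_left_mono) auto
    qed
    finally have g: "\<gamma> * x \<le> 2 / 2.7" .
    show ?thesis
    proof (rule ccontr)
      assume "\<not> x < 0.165"
      then have "(2 + 16 * 0.165) * 0.165 \<le> \<gamma> * x" using \<gamma>x by (intro mult_mono) auto
      with g show False by simp
    qed
  qed
  have sb: "sbar > 0" using K0 K T0 by (simp add: sbar)
  have smx: "real (s i) \<le> smax" if "i < T" for i
    unfolding smax using that by (auto intro!: Max_ge)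
  have "(\<Sum>i<T. real (s i)) \<le> (\<Sum>i<T. smax)" by (intro sum_mono smx) auto
  then have "sbar \<le> smax" unfolding sbar using T0 by (simp add: field_simps)
  then have \<theta>1: "\<theta> \<ge> 1" unfolding \<theta> using sb by simp
  \<comment> \<open>The largest sampling probability \<open>smax / N\<close>, rewritten in the
    quantities of the condition on \<open>T\<close>.\<close>
  define Q where "Q = \<theta> * k / real T"
  have Q: "smax / real N = Q"
    unfolding Q_def \<theta> k using sb T0 N0 K0 by (simp add: sbar K[symmetric])
  have qQ: "real (s i) / real N \<le> Q" if "i < T" for i
    unfolding Q[symmetric] using smx[OF that] N0 by (simp add: divide_right_mono)
  have Q0: "Q > 0" unfolding Q_def using \<theta>1 k0 T0 by simp
  have TT': "\<gamma> * \<theta>\<^sup>2 * k\<^sup>2 \<le> \<epsilon> * real T" using TT \<epsilon> by (simp add: field_simps)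
  \<comment> \<open>The maximum is at least the mean, so \<open>\<theta> \<ge> 1\<close> and one
    factor \<open>\<theta>\<close> may be added before the condition on \<open>T\<close> is
    applied.\<close>
  have "Q \<le> a"
  proof -
    have "\<gamma> * k * (\<theta> * k) \<le> \<gamma> * k * (\<theta> * (\<theta> * k))"
      using \<theta>1 k0 \<gamma>0 by (intro mult_left_mono) auto
    also have "\<dots> = \<gamma> * \<theta>\<^sup>2 * k\<^sup>2" by (simp add: power2_eq_square)
    finally have "\<gamma> * k * (\<theta> * k) \<le> \<epsilon> * real T" using TT' by simp
    then show ?thesis unfolding Q_def a_def using \<gamma>0 k0 T0 by (simp add: field_simps)
  qed
  then have "Q < 1" "Q * \<sigma> \<le> x" using a1 \<sigma>0 by (auto simp: x_a)
  have "real (s i) / real N < 1 \<and> real (s i) / real N * \<sigma> \<le> x" if "i < T" for i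
    using qQ[OF that] \<open>Q < 1\<close> \<open>Q * \<sigma> \<le> x\<close> mult_right_mono[OF qQ[OF that], of \<sigma>] \<sigma>0 by simp
  moreover have "(\<Sum>i<T. (\<sigma>\<^sup>2 + 1) * \<gamma> / 2 * (real (s i) / real N)\<^sup>2) \<le> \<sigma>\<^sup>2 * \<epsilon> + ln \<delta>"
  proof -
    have "(\<Sum>i<T. (\<sigma>\<^sup>2 + 1) * \<gamma> / 2 * (real (s i) / real N)\<^sup>2) \<le> (\<Sum>i<T. (\<sigma>\<^sup>2 + 1) * \<gamma> / 2 * Q\<^sup>2)"
      using qQ \<gamma>0 by (intro sum_mono mult_left_mono power_mono) auto
    also have "\<dots> = (\<sigma>\<^sup>2 + 1) / 2 * (\<gamma> * (real T * Q\<^sup>2))" by simp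
    also have "\<gamma> * (real T * Q\<^sup>2) = \<gamma> * \<theta>\<^sup>2 * k\<^sup>2 / real T"
      using T0 by (simp add: Q_def power2_eq_square)
    also have "\<dots> \<le> \<epsilon>" using TT' T0 by (simp add: field_simps)
    finally have "(\<Sum>i<T. (\<sigma>\<^sup>2 + 1) * \<gamma> / 2 * (real (s i) / real N)\<^sup>2) \<le> (\<sigma>\<^sup>2 + 1) / 2 * \<epsilon>"
      by (simp add: mult_left_mono)
    also have "\<dots> = (\<sigma>\<^sup>2 * \<epsilon> + \<epsilon>) / 2" by (simp add: field_simps)
    \<comment> \<open>With \<open>\<sigma>^2 * \<epsilon> = 2 * (\<epsilon> + \<Lambda>)\<close> the
      left side is \<open>3 * \<epsilon> / 2 + \<Lambda>\<close> and the right side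
      \<open>2 * \<epsilon> + \<Lambda>\<close>.\<close>
    also have "\<dots> \<le> \<sigma>\<^sup>2 * \<epsilon> - \<Lambda>" unfolding s2e using \<epsilon> by simp
    also have "\<dots> = \<sigma>\<^sup>2 * \<epsilon> + ln \<delta>" using \<delta> by (simp add: \<Lambda>_def ln_div)
    finally show ?thesis .
  qed
  ultimately show "x < 0.165" "\<sigma>\<^sup>2 \<ge> 34" "\<gamma> \<ge> 2 + 16 * x"
    "\<And>i. i < T \<Longrightarrow> real (s i) / real N < 1 \<and> real (s i) / real N * \<sigma> \<le> x"
    "(\<Sum>i<T. (\<sigma>\<^sup>2 + 1) * \<gamma> / 2 * (real (s i) / real N)\<^sup>2) \<le> \<sigma>\<^sup>2 * \<epsilon> + ln \<delta>"
    using x165 s34 \<gamma>x by blast+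
qed

theorem theorem3p1:
  fixes N T :: nat and s :: "nat \<Rightarrow> nat"
    and K k sbar smax \<theta> \<epsilon> \<delta> \<sigma> \<gamma> C :: real
    and f :: "real^'m \<Rightarrow> 'x \<Rightarrow> real"
    and R :: "'r measure"
    and server :: "'r \<Rightarrow> nat \<Rightarrow> (nat \<Rightarrow> real^'m) \<Rightarrow> real^'m"
  assumes "N \<ge> 10000" and "T \<ge> 1"
    and "\<forall>i<T. 0 < s i \<and> s i \<le> N"
    and "K = (\<Sum>i<T. real (s i))"
    and "k = K / real N"
    and "sbar = (1 / real T) * (\<Sum>i<T. real (s i))"
    and "smax = real (Max (s ` {..<T}))"
    and "\<theta> = smax / sbar"
    and "\<theta> \<le> 6.85"
    and "\<epsilon> > 0" and "\<delta> > 0" and "\<sigma> > 0"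
    and "\<sigma> = sqrt (2 * (\<epsilon> + ln (1 / \<delta>)) / \<epsilon>)"
    and "\<delta> \<le> 1 / real N"
    and "\<epsilon> < 0.5"
    and "gamma_admissible \<epsilon> k \<sigma> \<gamma>"
    and "\<forall>g. gamma_admissible \<epsilon> k \<sigma> g \<longrightarrow> \<gamma> \<le> g"
    and "(2 / exp 1)\<^sup>2 * k\<^sup>2 \<ge> 1 / 2 + ln (1 / \<delta>)"
    and "real T \<ge> \<gamma> * \<theta>\<^sup>2 / \<epsilon> * k\<^sup>2"
    and "C > 0"
    and "\<forall>w \<xi>. (\<lambda>v. f v \<xi>) differentiable (at w)"
    and "server_behaviour R server"
  shows "differentially_private \<epsilon> \<delta> N (outputs T) (dp_sgd N T s C \<sigma> f R server)"
  unfolding differentially_private_def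
proof (intro allI impI ballI)
  fix d d' :: "'x set" and S :: "(nat \<Rightarrow> real^'m) set"
  assume adj: "adjacent N d d'" and S: "S \<in> sets (outputs T)"
  define x where "x = \<epsilon> / (\<gamma> * k) * \<sigma>"
  note x = dp_sgd_parameters(1)[OF assms(1-8,10-16,18,19), folded x_def]
    and \<sigma>34 = dp_sgd_parameters(2)[OF assms(1-8,10-16,18,19)]
    and \<gamma> = dp_sgd_parameters(3)[OF assms(1-8,10-16,18,19), folded x_def]
    and q = dp_sgd_parameters(4)[OF assms(1-8,10-16,18,19), folded x_def]
    and total = dp_sgd_parameters(5)[OF assms(1-8,10-16,18,19)]
  have R: "prob_space R" and srv: "\<And>i. (\<lambda>(\<omega>, U). server \<omega> i U) \<in> borel_measurable (R \<Otimes>\<^sub>M outputs i)"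
    using assms(22) by (auto simp: server_behaviour_def)
  have fin: "finite d" "finite d'" using adj by (auto simp: adjacent_def)
  have l: "\<sigma>\<^sup>2 > 0" using assms(12) by simp
  have R': "R \<in> space (prob_algebra R)" using R by (simp add: space_prob_algebra)
  note run = measurable_dp_sgd_run[OF assms(20,12) _ assms(21) srv, where s = s and N = N and i = T]
  define A where "A = (\<lambda>i. 1 + (\<sigma>\<^sup>2 + 1) * \<gamma> / 2 * (real (s i) / real N)\<^sup>2)"
  define B where "B = (\<Prod>i<T. A i powr (1 / (\<sigma>\<^sup>2 + 1)))"
  have \<gamma>0: "\<gamma> > 0" using assms(16) by (simp add: gamma_admissible_def Let_def)
  have A: "A i \<ge> 1" for i using \<gamma>0 by (simp add: A_def)
  have B0: "B \<ge> 0" unfolding B_def by (intro prod_nonneg) simp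
  have B: "B powr (\<sigma>\<^sup>2 + 1) \<le> exp (\<sigma>\<^sup>2 * \<epsilon>) * \<delta>"
  proof -
    have "B powr (\<sigma>\<^sup>2 + 1) = (\<Prod>i<T. (A i powr (1 / (\<sigma>\<^sup>2 + 1))) powr (\<sigma>\<^sup>2 + 1))"
      unfolding B_def by (rule prod_powr_distrib)
    also have "\<dots> = (\<Prod>i<T. A i)"
    proof (intro prod.cong refl)
      fix i
      have "A i > 0" using A[of i] by linarith
      moreover have "\<sigma>\<^sup>2 + 1 \<noteq> 0" using l by linarith
      ultimately show "(A i powr (1 / (\<sigma>\<^sup>2 + 1))) powr (\<sigma>\<^sup>2 + 1) = A i" by (simp add: powr_powr)
    qed
    \<comment> \<open>\<open>1 + t \<le> exp t\<close> turns the product of the round moments into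
      the sum bounded by the parameter conditions.\<close>
    also have "\<dots> \<le> (\<Prod>i<T. exp (A i - 1))"
    proof (rule prod_mono)
      fix i
      show "0 \<le> A i \<and> A i \<le> exp (A i - 1)" using A[of i] exp_ge_add_one_self[of "A i - 1"] by linarith
    qed
    also have "\<dots> = exp (\<Sum>i<T. A i - 1)" by (simp add: exp_sum)
    also have "\<dots> \<le> exp (\<sigma>\<^sup>2 * \<epsilon> + ln \<delta>)" using total by (simp add: A_def)
    also have "\<dots> = exp (\<sigma>\<^sup>2 * \<epsilon>) * \<delta>" using assms(11) by (simp add: exp_add)
    finally show ?thesis .
  qed
  \<comment> \<open>The server's randomness has the same law \<open>R\<close> on both sides, so
    averaging over \<open>\<omega>\<close> preserves the constant obtained for each fixed
    \<open>\<omega>\<close>.\<close>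
  have "holder_dominated (\<sigma>\<^sup>2) (1 * B) (dp_sgd N T s C \<sigma> f R server d) (dp_sgd N T s C \<sigma> f R server d')"
    unfolding dp_sgd_def B_def A_def
    by (rule holder_dominated_bind[OF R' R' run[OF fin(1)] run[OF fin(2)] holder_dominated_refl[OF R l]
          holder_dominated_dp_sgd_run[OF adj assms(20,21) srv _ x assms(12) \<sigma>34 \<gamma> q] l])
      (auto intro!: prod_nonneg)
  moreover have "dp_sgd N T s C \<sigma> f R server e \<in> space (prob_algebra (outputs T))" if "finite e" for e
    unfolding dp_sgd_def
    using measurable_space[OF measurable_bind_prob_space[OF measurable_const[OF R'] run[OF that]], of "()" "count_space UNIV"]
    by simp
  then have "prob_space (dp_sgd N T s C \<sigma> f R server e)" "sets (dp_sgd N T s C \<sigma> f R server e) = sets (outputs T)"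
    if "finite e" for e
    using that by (auto simp: space_prob_algebra)
  ultimately show "measure (dp_sgd N T s C \<sigma> f R server d) S \<le> exp \<epsilon> * measure (dp_sgd N T s C \<sigma> f R server d') S + \<delta>"
    using holder_dominated_imp_measure_le[of "\<sigma>\<^sup>2" B "dp_sgd N T s C \<sigma> f R server d" "dp_sgd N T s C \<sigma> f R server d'" S \<epsilon> \<delta>]
      S fin l B0 B assms(11) by simp
qed

end
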